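(* Let $X$ be a coverable uniform space and let $\Lambda=\mathcal{C}(X)$ be its covering base. Then $\{X_E,\phi_{EF}\}_{E\in\Lambda}$ and $\{\delta_E(X),\theta_{EF}\}_{E\in\Lambda}$ comprise an inverse system of discrete covers, and $\phi:\widetilde{X}\to X$ is a cover with covering group $\delta_1(X)$.
   Context: All entourages are taken to be symmetric. Fix a basepoint $*\in X$. For an entourage $E$ of a uniform space $X$, an $E$-chain from $p$ to $q$ is a finite sequence $\{x_0=p,\dots,x_n=q\}$ with $(x_i,x_{i+1})\in E$ for all $i$; it is an $E$-loop if $p=q$. Two $E$-chains with the same endpoints are $E$-homotopic if one is obtained from the other in finitely many steps, each adding or removing a single point, always keeping the endpoints fixed and keeping an $E$-chain at each stage (in particular $\{p\}$ and $\{p,p\}$ are $E$-homotopic); $[\alpha]_E$ is the class of $\alpha$. $X_E$ is the set of $E$-homotopy classes of $E$-chains starting at $*$. For an entourage $D\subset E$ let $D^*$ be the set of pairs $([*=x_0,\dots,x_n,y]_E,[*=x_0,\dots,x_n,z]_E)$ with $(y,z)\in D$; $X_E$ carries the uniformity with base $\{D^*:D\subset E\}$. The endpoint map is $\phi_{XE}:X_E\to X$, and for $F\subset E$, $\phi_{EF}:X_F\to X_E$ is $[\alpha]_F\mapsto[\alpha]_E$. $\widetilde{X}=\varprojlim X_E$ (over all entourages, ordered by reverse inclusion, with the inverse limit uniformity), with projections $\phi_E:\widetilde{X}\to X_E$ and $\phi:\widetilde{X}\to X=X_{X\times X}$. $X$ is coverable if its uniformity has a base, containing $X\times X$, of entourages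 $E$ for which $\phi_E$ is surjective; the covering base $\mathcal{C}(X)$ is the collection of all entourages $E$ with $\phi_E$ surjective. $\delta_E(X)$ is the group of $E$-homotopy classes of $E$-loops at $*$ under concatenation, acting on $X_E$ by $[\lambda]_E\cdot[\alpha]_E=[\lambda*\alpha]_E$ (concatenation of $\alpha$ after $\lambda$); $\theta_{EF}:\delta_F(X)\to\delta_E(X)$ is the restriction of $\phi_{EF}$, for $F\subset E$; $\delta_1(X)=\varprojlim\delta_E(X)$ acts coordinatewise on $\widetilde X$. Group actions and covers. A group $G$ acting on a uniform space $X$ by uniform homeomorphisms acts isomorphically if the uniformity of $X$ has a base of entourages $E$ with $(g\times g)(E)=E$ for all $g\in G$; it acts discretely if there is an entourage $E$ such that $(g(x),x)\in E$ for some $x\in X$ implies $g=1$; it acts prodiscretely if the action is an inverse limit of discrete actions, i.e. $X=\varprojlim X_\alpha$ (with the inverse limit uniformity, projections surjective), $G=\varprojlim G_\alpha$ over the same directed set, each $G_\alpha$ acts discretely on $X_\alpha$ by uniform homeomorphisms, the bonding maps $X_\beta\to X_\alpha$ (uniformly continuous) are equivariant with respect to the bonding homomorphisms $G_\beta\to G_\alpha$, and $G$ acts coordinatewise. $X/G$ carries the quotient uniformity, with base the images of entourages of $X$. A discrete cover (respectively cover) with covering group $G$ is a map which, up to uniform homeomorphism of the target, is the quotient map $X\to X/G$ of a discrete (respectively prodiscrete) isomorphic action of $G$. That the two systems comprise an inverse system of discrete covers means: each $\delta_E(X)$ acts discretely and isomorphically on $X_E$, one has $\phi_{EF}(g\cdot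 x)=\theta_{EF}(g)\cdot\phi_{EF}(x)$ for all $F\subset E$ in $\Lambda$, $g\in\delta_F(X)$, $x\in X_F$, and each bonding map $\phi_{EF}:X_F\to X_E$ is a discrete cover. *)

theory Defs
  imports Complex_Main "HOL-Algebra.Group_Action" "HOL-Algebra.Product_Groups"
begin

section \<open>Uniform spaces on carrier sets\<close>

text \<open>
  The spaces of chain classes depend on an entourage, so they cannot be instances of the class
  \<^class>\<open>uniform_space\<close>. They are represented by a carrier and a filter living on
  its square; the axioms are those of the class, relativised to the carrier.
\<close>

record 'x uspace =
  points :: "'x set"
  unif :: "('x \<times> 'x) filter"

definition uniform_space_on :: "'x uspace \<Rightarrow> bool" where
  "uniform_space_on X \<longleftrightarrow>
     unif X \<le> principal (points X \<times> points X) \<and>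
     (\<forall>P. eventually P (unif X) \<longrightarrow> (\<forall>x\<in>points X. P (x, x))) \<and>
     (\<forall>P. eventually P (unif X) \<longrightarrow> eventually (\<lambda>(x, y). P (y, x)) (unif X)) \<and>
     (\<forall>P. eventually P (unif X) \<longrightarrow>
        (\<exists>Q. eventually Q (unif X) \<and> (\<forall>x y z. Q (x, y) \<longrightarrow> Q (y, z) \<longrightarrow> P (x, z))))"

definition class_uspace :: "'a::uniform_space uspace" where
  "class_uspace = \<lparr>points = UNIV, unif = uniformity\<rparr>"

lemma uniform_space_on_class_uspace: "uniform_space_on class_uspace"
  unfolding uniform_space_on_def class_uspace_def
  using uniformity_trans by (auto simp: uniformity_refl uniformity_sym simp del: split_paired_All)

text \<open>Entourages are symmetric by convention.\<close>

definition entourage :: "'x uspace \<Rightarrow> 'x rel \<Rightarrow> bool" where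
  "entourage X E \<longleftrightarrow> E \<subseteq> points X \<times> points X \<and> sym E \<and> eventually (\<lambda>p. p \<in> E) (unif X)"

definition uniformity_base :: "'x uspace \<Rightarrow> 'x rel set \<Rightarrow> bool" where
  "uniformity_base X B \<longleftrightarrow>
     (\<forall>E\<in>B. entourage X E) \<and> (\<forall>D. entourage X D \<longrightarrow> (\<exists>E\<in>B. E \<subseteq> D))"

definition ucont :: "'x uspace \<Rightarrow> 'y uspace \<Rightarrow> ('x \<Rightarrow> 'y) \<Rightarrow> bool" where
  "ucont X Y f \<longleftrightarrow>
     f \<in> points X \<rightarrow> points Y \<and> filterlim (\<lambda>(x, y). (f x, f y)) (unif Y) (unif X)"

definition uhomeo :: "'x uspace \<Rightarrow> 'y uspace \<Rightarrow> ('x \<Rightarrow> 'y) \<Rightarrow> bool" where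
  "uhomeo X Y f \<longleftrightarrow>
     bij_betw f (points X) (points Y) \<and> ucont X Y f \<and> ucont Y X (inv_into (points X) f)"


section \<open>Inverse systems and inverse limits\<close>

text \<open>
  Throughout, \<open>le_idx \<alpha> \<beta>\<close> means that \<open>\<beta>\<close> is beyond \<open>\<alpha>\<close>, and the bonding map
  \<open>f \<alpha> \<beta>\<close> goes from the object at \<open>\<beta>\<close> to the object at \<open>\<alpha>\<close>.
\<close>

definition directed_set :: "'i set \<Rightarrow> ('i \<Rightarrow> 'i \<Rightarrow> bool) \<Rightarrow> bool" where
  "directed_set I le_idx \<longleftrightarrow>
     I \<noteq> {} \<and> (\<forall>\<alpha>\<in>I. le_idx \<alpha> \<alpha>) \<and>
     (\<forall>\<alpha>\<in>I. \<forall>\<beta>\<in>I. \<forall>\<gamma>\<in>I. le_idx \<alpha> \<beta> \<longrightarrow> le_idx \<beta> \<gamma> \<longrightarrow> le_idx \<alpha> \<gamma>) \<and>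
     (\<forall>\<alpha>\<in>I. \<forall>\<beta>\<in>I. \<exists>\<gamma>\<in>I. le_idx \<alpha> \<gamma> \<and> le_idx \<beta> \<gamma>)"

definition functorial ::
    "'i set \<Rightarrow> ('i \<Rightarrow> 'i \<Rightarrow> bool) \<Rightarrow> ('i \<Rightarrow> 'x set) \<Rightarrow> ('i \<Rightarrow> 'i \<Rightarrow> 'x \<Rightarrow> 'x) \<Rightarrow> bool" where
  "functorial I le_idx S f \<longleftrightarrow>
     (\<forall>\<alpha>\<in>I. \<forall>x\<in>S \<alpha>. f \<alpha> \<alpha> x = x) \<and>
     (\<forall>\<alpha>\<in>I. \<forall>\<beta>\<in>I. \<forall>\<gamma>\<in>I. le_idx \<alpha> \<beta> \<longrightarrow> le_idx \<beta> \<gamma> \<longrightarrow>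
        (\<forall>x\<in>S \<gamma>. f \<alpha> \<beta> (f \<beta> \<gamma> x) = f \<alpha> \<gamma> x))"

definition uspace_inverse_system ::
    "'i set \<Rightarrow> ('i \<Rightarrow> 'i \<Rightarrow> bool) \<Rightarrow> ('i \<Rightarrow> 'x uspace) \<Rightarrow> ('i \<Rightarrow> 'i \<Rightarrow> 'x \<Rightarrow> 'x) \<Rightarrow> bool" where
  "uspace_inverse_system I le_idx X f \<longleftrightarrow>
     directed_set I le_idx \<and> (\<forall>\<alpha>\<in>I. uniform_space_on (X \<alpha>)) \<and>
     (\<forall>\<alpha>\<in>I. \<forall>\<beta>\<in>I. le_idx \<alpha> \<beta> \<longrightarrow> ucont (X \<beta>) (X \<alpha>) (f \<alpha> \<beta>)) \<and>
     functorial I le_idx (\<lambda>\<alpha>. points (X \<alpha>)) f"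

definition group_inverse_system ::
    "'i set \<Rightarrow> ('i \<Rightarrow> 'i \<Rightarrow> bool) \<Rightarrow> ('i \<Rightarrow> 'g monoid) \<Rightarrow> ('i \<Rightarrow> 'i \<Rightarrow> 'g \<Rightarrow> 'g) \<Rightarrow> bool" where
  "group_inverse_system I le_idx G h \<longleftrightarrow>
     directed_set I le_idx \<and> (\<forall>\<alpha>\<in>I. group (G \<alpha>)) \<and>
     (\<forall>\<alpha>\<in>I. \<forall>\<beta>\<in>I. le_idx \<alpha> \<beta> \<longrightarrow> h \<alpha> \<beta> \<in> hom (G \<beta>) (G \<alpha>)) \<and>
     functorial I le_idx (\<lambda>\<alpha>. carrier (G \<alpha>)) h"

definition threads ::
    "'i set \<Rightarrow> ('i \<Rightarrow> 'i \<Rightarrow> bool) \<Rightarrow> ('i \<Rightarrow> 'x set) \<Rightarrow> ('i \<Rightarrow> 'i \<Rightarrow> 'x \<Rightarrow> 'x) \<Rightarrow> ('i \<Rightarrow> 'x) set" where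
  "threads I le_idx S f =
     {u \<in> (\<Pi>\<^sub>E \<alpha>\<in>I. S \<alpha>). \<forall>\<alpha>\<in>I. \<forall>\<beta>\<in>I. le_idx \<alpha> \<beta> \<longrightarrow> f \<alpha> \<beta> (u \<beta>) = u \<alpha>}"

definition inverse_limit_uspace ::
    "'i set \<Rightarrow> ('i \<Rightarrow> 'i \<Rightarrow> bool) \<Rightarrow> ('i \<Rightarrow> 'x uspace) \<Rightarrow> ('i \<Rightarrow> 'i \<Rightarrow> 'x \<Rightarrow> 'x) \<Rightarrow> ('i \<Rightarrow> 'x) uspace" where
  "inverse_limit_uspace I le_idx X f =
     (let L = threads I le_idx (\<lambda>\<alpha>. points (X \<alpha>)) f in
      \<lparr>points = L,
       unif = inf (principal (L \<times> L))
                (INF \<alpha>\<in>I. filtercomap (\<lambda>(u, v). (u \<alpha>, v \<alpha>)) (unif (X \<alpha>)))\<rparr>)"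

definition inverse_limit_group ::
    "'i set \<Rightarrow> ('i \<Rightarrow> 'i \<Rightarrow> bool) \<Rightarrow> ('i \<Rightarrow> 'g monoid) \<Rightarrow> ('i \<Rightarrow> 'i \<Rightarrow> 'g \<Rightarrow> 'g) \<Rightarrow> ('i \<Rightarrow> 'g) monoid" where
  "inverse_limit_group I le_idx G h =
     (product_group I G)\<lparr>carrier := threads I le_idx (\<lambda>\<alpha>. carrier (G \<alpha>)) h\<rparr>"


section \<open>Group actions on uniform spaces\<close>

definition uniform_action :: "'g monoid \<Rightarrow> 'x uspace \<Rightarrow> ('g \<Rightarrow> 'x \<Rightarrow> 'x) \<Rightarrow> bool" where
  "uniform_action G X act \<longleftrightarrow>
     uniform_space_on X \<and> group_action G (points X) act \<and> (\<forall>g\<in>carrier G. uhomeo X X (act g))"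

definition isomorphic_action :: "'g monoid \<Rightarrow> 'x uspace \<Rightarrow> ('g \<Rightarrow> 'x \<Rightarrow> 'x) \<Rightarrow> bool" where
  "isomorphic_action G X act \<longleftrightarrow>
     uniform_action G X act \<and>
     (\<exists>B. uniformity_base X B \<and> (\<forall>E\<in>B. \<forall>g\<in>carrier G. map_prod (act g) (act g) ` E = E))"

definition discrete_action :: "'g monoid \<Rightarrow> 'x uspace \<Rightarrow> ('g \<Rightarrow> 'x \<Rightarrow> 'x) \<Rightarrow> bool" where
  "discrete_action G X act \<longleftrightarrow>
     uniform_action G X act \<and>
     (\<exists>E. entourage X E \<and>
        (\<forall>g\<in>carrier G. (\<exists>x\<in>points X. (act g x, x) \<in> E) \<longrightarrow> g = \<one>\<^bsub>G\<^esub>))"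

definition equivariant_bonds ::
    "'i set \<Rightarrow> ('i \<Rightarrow> 'i \<Rightarrow> bool) \<Rightarrow> ('i \<Rightarrow> 'x uspace) \<Rightarrow> ('i \<Rightarrow> 'i \<Rightarrow> 'x \<Rightarrow> 'x) \<Rightarrow>
     ('i \<Rightarrow> 'g monoid) \<Rightarrow> ('i \<Rightarrow> 'i \<Rightarrow> 'g \<Rightarrow> 'g) \<Rightarrow> ('i \<Rightarrow> 'g \<Rightarrow> 'x \<Rightarrow> 'x) \<Rightarrow> bool" where
  "equivariant_bonds I le_idx X f G h act \<longleftrightarrow>
     (\<forall>\<alpha>\<in>I. \<forall>\<beta>\<in>I. le_idx \<alpha> \<beta> \<longrightarrow>
        (\<forall>g\<in>carrier (G \<beta>). \<forall>x\<in>points (X \<beta>). f \<alpha> \<beta> (act \<beta> g x) = act \<alpha> (h \<alpha> \<beta> g) (f \<alpha> \<beta> x)))"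

text \<open>
  The identifications of the space and of the group with the respective limits are the
  uniform homeomorphism \<open>p\<close> and the isomorphism \<open>q\<close>. The types of the index set, of the
  spaces and of the groups of the system cannot be quantified inside the formula, so they are
  parameters.
\<close>

definition prodiscrete_action ::
    "'i itself \<Rightarrow> 'y itself \<Rightarrow> 'h itself \<Rightarrow> 'g monoid \<Rightarrow> 'x uspace \<Rightarrow> ('g \<Rightarrow> 'x \<Rightarrow> 'x) \<Rightarrow> bool" where
  "prodiscrete_action TI TY TH G X act \<longleftrightarrow>
     uniform_action G X act \<and>
     (\<exists>(I :: 'i set) le_idx (Y :: 'i \<Rightarrow> 'y uspace) f (H :: 'i \<Rightarrow> 'h monoid) h actY p q.
        uspace_inverse_system I le_idx Y f \<and> group_inverse_system I le_idx H h \<and>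
        (\<forall>\<alpha>\<in>I. discrete_action (H \<alpha>) (Y \<alpha>) (actY \<alpha>)) \<and>
        equivariant_bonds I le_idx Y f H h actY \<and>
        uhomeo X (inverse_limit_uspace I le_idx Y f) p \<and>
        (\<forall>\<alpha>\<in>I. (\<lambda>x. p x \<alpha>) ` points X = points (Y \<alpha>)) \<and>
        q \<in> iso G (inverse_limit_group I le_idx H h) \<and>
        (\<forall>g\<in>carrier G. \<forall>x\<in>points X. \<forall>\<alpha>\<in>I. p (act g x) \<alpha> = actY \<alpha> (q g \<alpha>) (p x \<alpha>)))"


section \<open>Quotients and covers\<close>

text \<open>
  A relation belongs to the image filter iff it contains the image of an entourage, so the
  images of entourages form a base of it.
\<close>

definition quotient_uspace :: "'g monoid \<Rightarrow> 'x uspace \<Rightarrow> ('g \<Rightarrow> 'x \<Rightarrow> 'x) \<Rightarrow> 'x set uspace" where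
  "quotient_uspace G X act =
     \<lparr>points = orbits G (points X) act,
      unif = filtermap (\<lambda>(x, y). (orbit G act x, orbit G act y)) (unif X)\<rparr>"

definition quotient_map_upto_uhomeo ::
    "'g monoid \<Rightarrow> ('g \<Rightarrow> 'x \<Rightarrow> 'x) \<Rightarrow> 'x uspace \<Rightarrow> 'y uspace \<Rightarrow> ('x \<Rightarrow> 'y) \<Rightarrow> bool" where
  "quotient_map_upto_uhomeo G act X Y f \<longleftrightarrow>
     (\<exists>k. uhomeo (quotient_uspace G X act) Y k \<and> (\<forall>x\<in>points X. f x = k (orbit G act x)))"

text \<open>
  A discrete action on a nonempty space is free, so the group embeds into the space along an
  orbit. Letting the group range over carriers in the type of points therefore loses no
  generality.
\<close>

definition discrete_cover :: "'x uspace \<Rightarrow> 'y uspace \<Rightarrow> ('x \<Rightarrow> 'y) \<Rightarrow> bool" where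
  "discrete_cover X Y f \<longleftrightarrow>
     (\<exists>(G :: 'x monoid) act. discrete_action G X act \<and> isomorphic_action G X act \<and>
        quotient_map_upto_uhomeo G act X Y f)"

definition cover_with_group ::
    "'i itself \<Rightarrow> 'z itself \<Rightarrow> 'h itself \<Rightarrow>
     'g monoid \<Rightarrow> ('g \<Rightarrow> 'x \<Rightarrow> 'x) \<Rightarrow> 'x uspace \<Rightarrow> 'y uspace \<Rightarrow> ('x \<Rightarrow> 'y) \<Rightarrow> bool" where
  "cover_with_group TI TZ TH G act X Y f \<longleftrightarrow>
     prodiscrete_action TI TZ TH G X act \<and> isomorphic_action G X act \<and>
     quotient_map_upto_uhomeo G act X Y f"

definition inverse_system_of_discrete_covers ::
    "'i set \<Rightarrow> ('i \<Rightarrow> 'i \<Rightarrow> bool) \<Rightarrow> ('i \<Rightarrow> 'x uspace) \<Rightarrow> ('i \<Rightarrow> 'i \<Rightarrow> 'x \<Rightarrow> 'x) \<Rightarrow>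
     ('i \<Rightarrow> 'g monoid) \<Rightarrow> ('i \<Rightarrow> 'i \<Rightarrow> 'g \<Rightarrow> 'g) \<Rightarrow> ('i \<Rightarrow> 'g \<Rightarrow> 'x \<Rightarrow> 'x) \<Rightarrow> bool" where
  "inverse_system_of_discrete_covers I le_idx X f G h act \<longleftrightarrow>
     uspace_inverse_system I le_idx X f \<and> group_inverse_system I le_idx G h \<and>
     (\<forall>\<alpha>\<in>I. discrete_action (G \<alpha>) (X \<alpha>) (act \<alpha>) \<and> isomorphic_action (G \<alpha>) (X \<alpha>) (act \<alpha>)) \<and>
     equivariant_bonds I le_idx X f G h act \<and>
     (\<forall>\<alpha>\<in>I. \<forall>\<beta>\<in>I. le_idx \<alpha> \<beta> \<longrightarrow> discrete_cover (X \<beta>) (X \<alpha>) (f \<alpha> \<beta>))"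


section \<open>Chains and their homotopy classes\<close>

definition chain :: "'a rel \<Rightarrow> 'a list \<Rightarrow> bool" where
  "chain E xs \<longleftrightarrow> xs \<noteq> [] \<and> successively (\<lambda>x y. (x, y) \<in> E) xs"

text \<open>
  The inserted point may be first or last in the list; the condition on the endpoints then
  makes it a repetition of the endpoint, as in the step from \<open>[p]\<close> to \<open>[p, p]\<close>.
\<close>

definition adds_point :: "'a rel \<Rightarrow> 'a list \<Rightarrow> 'a list \<Rightarrow> bool" where
  "adds_point E xs ys \<longleftrightarrow>
     chain E xs \<and> chain E ys \<and> hd xs = hd ys \<and> last xs = last ys \<and>
     (\<exists>us z vs. xs = us @ vs \<and> ys = us @ [z] @ vs)"

definition homotopic :: "'a rel \<Rightarrow> 'a list \<Rightarrow> 'a list \<Rightarrow> bool" where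
  "homotopic E = (\<lambda>xs ys. adds_point E xs ys \<or> adds_point E ys xs)\<^sup>*\<^sup>*"

definition hclass :: "'a rel \<Rightarrow> 'a list \<Rightarrow> 'a list set" where
  "hclass E xs = {ys. homotopic E xs ys}"

lemma homotopic_refl: "homotopic E xs xs"
  by (simp add: homotopic_def)

lemma homotopic_sym: "homotopic E xs ys \<Longrightarrow> homotopic E ys xs"
  unfolding homotopic_def
  by (rule sympD[OF symp_rtranclp]) (auto simp: symp_def)

lemma homotopic_trans: "homotopic E xs ys \<Longrightarrow> homotopic E ys zs \<Longrightarrow> homotopic E xs zs"
  unfolding homotopic_def by (rule rtranclp_trans)

lemma hclass_eq_iff: "hclass E xs = hclass E ys \<longleftrightarrow> homotopic E xs ys"
  unfolding hclass_def by (blast intro: homotopic_refl homotopic_sym homotopic_trans)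

lemma homotopic_endpoints:
  assumes "homotopic E xs ys" shows "hd xs = hd ys \<and> last xs = last ys"
  using assms unfolding homotopic_def by (induction rule: rtranclp_induct) (auto simp: adds_point_def)

lemma chain_mono:
  assumes "chain F xs" "F \<subseteq> E" shows "chain E xs"
  using assms successively_mono[of "\<lambda>x y. (x, y) \<in> F" xs "\<lambda>x y. (x, y) \<in> E"]
  unfolding chain_def by blast

lemma homotopic_mono:
  assumes "homotopic F xs ys" "F \<subseteq> E" shows "homotopic E xs ys"
proof -
  have mono: "adds_point E us vs" if "adds_point F us vs" for us vs
    using that chain_mono[OF _ assms(2)] unfolding adds_point_def by blast
  show ?thesis
    using assms(1) unfolding homotopic_def
  proof (induction rule: rtranclp_induct)
    case (step y z)
    have "adds_point E y z \<or> adds_point E z y"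
      using step.hyps(2) mono by blast
    with step.IH show ?case
      by (rule rtranclp.rtrancl_into_rtrancl)
  qed simp
qed

text \<open>The endpoint map, and the maps sending the \<open>F\<close>-class of a chain to its \<open>E\<close>-class.\<close>

definition endpoint :: "'a list set \<Rightarrow> 'a" where
  "endpoint c = (THE y. \<exists>xs\<in>c. y = last xs)"

lemma endpoint_hclass: "endpoint (hclass E xs) = last xs"
  unfolding endpoint_def
proof (rule the_equality)
  show "\<exists>ys\<in>hclass E xs. last xs = last ys"
    by (rule bexI[of _ xs]) (simp_all add: hclass_def homotopic_refl)
next
  fix y assume "\<exists>ys\<in>hclass E xs. y = last ys"
  then obtain ys where "homotopic E xs ys" "y = last ys"
    by (auto simp: hclass_def)
  then show "y = last xs"
    using homotopic_endpoints[of E xs ys] by simp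
qed

definition class_map :: "'a rel \<Rightarrow> 'a rel \<Rightarrow> 'a list set \<Rightarrow> 'a list set" where
  "class_map E F c = (\<Union>xs\<in>c. hclass E xs)"

lemma class_map_hclass:
  assumes "F \<subseteq> E" shows "class_map E F (hclass F xs) = hclass E xs"
proof -
  have *: "hclass E ys = hclass E xs" if "ys \<in> hclass F xs" for ys
  proof -
    have "homotopic E xs ys"
      using that homotopic_mono[OF _ assms] by (simp add: hclass_def)
    then have "hclass E xs = hclass E ys"
      by (simp only: hclass_eq_iff)
    then show ?thesis ..
  qed
  have "xs \<in> hclass F xs"
    by (simp add: hclass_def homotopic_refl)
  moreover have "(\<Union>ys\<in>hclass F xs. hclass E ys) = (\<Union>ys\<in>hclass F xs. hclass E xs)"
    by (rule SUP_cong) (simp_all add: *)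
  ultimately show ?thesis
    unfolding class_map_def by blast
qed

text \<open>
  Concatenation of classes; the endpoint of the first chain is the starting point of the second
  and is listed only once.
\<close>

definition class_concat :: "'a rel \<Rightarrow> 'a list set \<Rightarrow> 'a list set \<Rightarrow> 'a list set" where
  "class_concat E c d = (\<Union>xs\<in>c. \<Union>ys\<in>d. hclass E (xs @ tl ys))"

lemma chain_concat:
  assumes "chain E xs" "chain E ys" "last xs = hd ys"
  shows "chain E (xs @ tl ys)" "hd (xs @ tl ys) = hd xs" "last (xs @ tl ys) = last ys"
proof -
  obtain y ts where ys: "ys = y # ts"
    using assms(2) by (cases ys) (auto simp: chain_def)
  show "chain E (xs @ tl ys)" "hd (xs @ tl ys) = hd xs" "last (xs @ tl ys) = last ys"
    using assms unfolding ys by (cases ts; auto simp: chain_def successively_append_iff)+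
qed

lemma adds_point_concat_right:
  assumes "adds_point E ys ys'" "chain E xs" "last xs = hd ys"
  shows "adds_point E (xs @ tl ys) (xs @ tl ys')"
proof -
  obtain us z vs where uv: "ys = us @ vs" "ys' = us @ [z] @ vs"
    using assms(1) by (auto simp: adds_point_def)
  have c: "chain E ys" "chain E ys'" "hd ys = hd ys'" "last ys = last ys'"
    using assms(1) by (auto simp: adds_point_def)
  have "\<exists>us' z' vs'. xs @ tl ys = us' @ vs' \<and> xs @ tl ys' = us' @ [z'] @ vs'"
  proof (cases us)
    case Nil
    then have "xs @ tl ys = xs @ tl vs" "xs @ tl ys' = xs @ [hd vs] @ tl vs"
      using uv c(1) by (auto simp: chain_def)
    then show ?thesis by blast
  next
    case (Cons u us')
    then have "xs @ tl ys = (xs @ us') @ vs" "xs @ tl ys' = (xs @ us') @ [z] @ vs"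
      using uv by auto
    then show ?thesis by blast
  qed
  then show ?thesis
    using chain_concat[OF assms(2) c(1)] chain_concat[OF assms(2) c(2)] assms(3) c
    by (simp add: adds_point_def)
qed

lemma adds_point_concat_left:
  assumes "adds_point E xs xs'" "chain E ys" "last xs = hd ys"
  shows "adds_point E (xs @ tl ys) (xs' @ tl ys)"
proof -
  obtain us z vs where uv: "xs = us @ vs" "xs' = us @ [z] @ vs"
    using assms(1) by (auto simp: adds_point_def)
  have c: "chain E xs" "chain E xs'" "hd xs = hd xs'" "last xs = last xs'"
    using assms(1) by (auto simp: adds_point_def)
  have "xs @ tl ys = us @ (vs @ tl ys)" "xs' @ tl ys = us @ [z] @ (vs @ tl ys)"
    using uv by auto
  then have "\<exists>us' z' vs'. xs @ tl ys = us' @ vs' \<and> xs' @ tl ys = us' @ [z'] @ vs'"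
    by blast
  then show ?thesis
    using chain_concat[OF c(1) assms(2)] chain_concat[OF c(2) assms(2)] assms(3) c
    by (simp add: adds_point_def)
qed

lemma homotopic_concat_right:
  assumes "homotopic E ys ys'" "chain E xs" "last xs = hd ys"
  shows "homotopic E (xs @ tl ys) (xs @ tl ys')"
  using assms(1) unfolding homotopic_def
proof (induction rule: rtranclp_induct)
  case (step y z)
  have "last xs = hd y" "last xs = hd z"
    using step.hyps(1) assms(3) homotopic_endpoints[of E ys y] step.hyps(2)
    by (auto simp: homotopic_def adds_point_def)
  then have "adds_point E (xs @ tl y) (xs @ tl z) \<or> adds_point E (xs @ tl z) (xs @ tl y)"
    using step.hyps(2) adds_point_concat_right assms(2) by blast
  then show ?case
    using step.IH by (rule rtranclp.rtrancl_into_rtrancl[rotated])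
qed simp

lemma homotopic_concat_left:
  assumes "homotopic E xs xs'" "chain E ys" "last xs = hd ys"
  shows "homotopic E (xs @ tl ys) (xs' @ tl ys)"
  using assms(1) unfolding homotopic_def
proof (induction rule: rtranclp_induct)
  case (step y z)
  have "last y = hd ys" "last z = hd ys"
    using step.hyps(1) assms(3) homotopic_endpoints[of E xs y] step.hyps(2)
    by (auto simp: homotopic_def adds_point_def)
  then have "adds_point E (y @ tl ys) (z @ tl ys) \<or> adds_point E (z @ tl ys) (y @ tl ys)"
    using step.hyps(2) adds_point_concat_left assms(2) by blast
  then show ?case
    using step.IH by (rule rtranclp.rtrancl_into_rtrancl[rotated])
qed simp

lemma homotopic_chain: "homotopic E xs ys \<Longrightarrow> chain E xs \<Longrightarrow> chain E ys"
  unfolding homotopic_def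
  by (induction rule: rtranclp_induct) (auto simp: adds_point_def)

lemma class_concat_hclass:
  assumes "chain E xs" "chain E ys" "last xs = hd ys"
  shows "class_concat E (hclass E xs) (hclass E ys) = hclass E (xs @ tl ys)"
proof -
  have *: "hclass E (xs' @ tl ys') = hclass E (xs @ tl ys)"
    if "homotopic E xs xs'" "homotopic E ys ys'" for xs' ys'
  proof -
    have l: "homotopic E (xs @ tl ys) (xs' @ tl ys)"
      by (rule homotopic_concat_left) (use that assms in auto)
    have "chain E xs'" "last xs' = hd ys"
      using homotopic_chain[OF that(1) assms(1)] homotopic_endpoints[OF that(1)] assms(3) by auto
    with that(2) have "homotopic E (xs' @ tl ys) (xs' @ tl ys')"
      by (rule homotopic_concat_right)
    with l have "homotopic E (xs @ tl ys) (xs' @ tl ys')"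
      by (rule homotopic_trans)
    then have "hclass E (xs @ tl ys) = hclass E (xs' @ tl ys')"
      by (simp only: hclass_eq_iff)
    then show ?thesis ..
  qed
  have "(\<Union>xs'\<in>hclass E xs. \<Union>ys'\<in>hclass E ys. hclass E (xs' @ tl ys')) =
        (\<Union>xs'\<in>hclass E xs. \<Union>ys'\<in>hclass E ys. hclass E (xs @ tl ys))"
    by (intro SUP_cong refl *) (simp_all add: hclass_def)
  moreover have "xs \<in> hclass E xs" "ys \<in> hclass E ys"
    by (simp_all add: hclass_def homotopic_refl)
  ultimately show ?thesis
    unfolding class_concat_def by blast
qed


section \<open>The spaces and groups attached to a based uniform space\<close>

abbreviation entourages :: "'a::uniform_space rel set" where
  "entourages \<equiv> {E. entourage class_uspace E}"

definition star_rel :: "'a \<Rightarrow> 'a rel \<Rightarrow> 'a rel \<Rightarrow> 'a list set rel" where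
  "star_rel b E D =
     {(hclass E (xs @ [y]), hclass E (xs @ [z])) | xs y z.
        xs \<noteq> [] \<and> hd xs = b \<and> chain E (xs @ [y]) \<and> chain E (xs @ [z]) \<and> (y, z) \<in> D}"

definition chain_space :: "'a::uniform_space \<Rightarrow> 'a rel \<Rightarrow> 'a list set uspace" where
  "chain_space b E =
     \<lparr>points = {hclass E xs | xs. chain E xs \<and> hd xs = b},
      unif = (INF D\<in>{D \<in> entourages. D \<subseteq> E}. principal (star_rel b E D))\<rparr>"

lemma star_rel_mono: "D \<subseteq> D' \<Longrightarrow> star_rel b E D \<subseteq> star_rel b E D'"
  unfolding star_rel_def by blast

lemma entourage_Int: "entourage X D \<Longrightarrow> entourage X D' \<Longrightarrow> entourage X (D \<inter> D')"
  by (auto simp: entourage_def sym_def eventually_conj_iff)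

lemma eventually_chain_space:
  assumes "E \<in> entourages"
  shows "eventually P (unif (chain_space b E)) \<longleftrightarrow>
           (\<exists>D\<in>entourages. D \<subseteq> E \<and> (\<forall>p\<in>star_rel b E D. P p))"
proof -
  have "eventually P (unif (chain_space b E)) \<longleftrightarrow>
          (\<exists>D\<in>{D \<in> entourages. D \<subseteq> E}. eventually P (principal (star_rel b E D)))"
    unfolding chain_space_def uspace.simps
  proof (rule eventually_INF_base)
    show "{D \<in> entourages. D \<subseteq> E} \<noteq> {}" using assms by blast
    fix D D' assume *: "D \<in> {D \<in> entourages. D \<subseteq> E}" "D' \<in> {D \<in> entourages. D \<subseteq> E}"
    have "star_rel b E (D \<inter> D') \<subseteq> star_rel b E D \<inter> star_rel b E D'"
      using star_rel_mono[of "D \<inter> D'"] by simp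
    moreover have "D \<inter> D' \<in> {D \<in> entourages. D \<subseteq> E}"
      using * by (auto intro: entourage_Int)
    ultimately show "\<exists>x\<in>{D \<in> entourages. D \<subseteq> E}.
        principal (star_rel b E x) \<le> inf (principal (star_rel b E D)) (principal (star_rel b E D'))"
      by (intro bexI[of _ "D \<inter> D'"]) auto
  qed
  then show ?thesis by (auto simp: eventually_principal)
qed

definition delta :: "'a::uniform_space \<Rightarrow> 'a rel \<Rightarrow> 'a list set monoid" where
  "delta b E =
     \<lparr>carrier = {hclass E xs | xs. chain E xs \<and> hd xs = b \<and> last xs = b},
      mult = class_concat E,
      one = hclass E [b]\<rparr>"

definition theta :: "'a::uniform_space \<Rightarrow> 'a rel \<Rightarrow> 'a rel \<Rightarrow> 'a list set \<Rightarrow> 'a list set" where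
  "theta b E F = restrict (class_map E F) (carrier (delta b F))"

definition delta_act :: "'a::uniform_space \<Rightarrow> 'a rel \<Rightarrow> 'a list set \<Rightarrow> 'a list set \<Rightarrow> 'a list set" where
  "delta_act b E c = restrict (class_concat E c) (points (chain_space b E))"

definition X_tilde :: "'a::uniform_space \<Rightarrow> ('a rel \<Rightarrow> 'a list set) uspace" where
  "X_tilde b = inverse_limit_uspace entourages (\<lambda>E F. F \<subseteq> E) (chain_space b) class_map"

definition delta_1 :: "'a::uniform_space \<Rightarrow> ('a rel \<Rightarrow> 'a list set) monoid" where
  "delta_1 b = inverse_limit_group entourages (\<lambda>E F. F \<subseteq> E) (delta b) (theta b)"

definition delta_1_act ::
    "'a::uniform_space \<Rightarrow> ('a rel \<Rightarrow> 'a list set) \<Rightarrow> ('a rel \<Rightarrow> 'a list set) \<Rightarrow> ('a rel \<Rightarrow> 'a list set)" where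
  "delta_1_act b g =
     (\<lambda>u\<in>points (X_tilde b). \<lambda>E\<in>entourages. delta_act b E (g E) (u E))"

text \<open>
  The projection to the coordinate of the full relation, whose chain space is identified with
  the underlying space by the endpoint map.
\<close>

definition phi :: "('a::uniform_space rel \<Rightarrow> 'a list set) \<Rightarrow> 'a" where
  "phi u = endpoint (u UNIV)"

lemma homotopic_UNIV:
  assumes "xs \<noteq> []"
  shows "homotopic UNIV xs [hd xs, last xs]"
proof -
  have chain: "chain UNIV zs \<longleftrightarrow> zs \<noteq> []" for zs :: "'a list"
    by (induction zs rule: induct_list012) (auto simp: chain_def)
  have step: "homotopic UNIV xs ys"
    if "adds_point UNIV xs ys \<or> adds_point UNIV ys xs" for xs ys :: "'a list"
    unfolding homotopic_def using that by (rule r_into_rtranclp)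
  have "homotopic UNIV (x # ys) [x, last (x # ys)]" for x and ys :: "'a list"
  proof (induction ys)
    case Nil
    have "\<exists>us z vs. [x] = us @ vs \<and> [x, x] = us @ [z] @ vs"
      by (intro exI[of _ "[]"] exI[of _ x] exI[of _ "[x]"]) simp
    then have "adds_point UNIV [x] [x, x]"
      by (simp add: adds_point_def chain)
    then show ?case using step[of "[x]" "[x, x]"] by simp
  next
    case (Cons y ys)
    show ?case
    proof (cases "ys = []")
      case True
      then show ?thesis by (simp add: homotopic_refl)
    next
      case False
      have "\<exists>us z vs. x # ys = us @ vs \<and> x # y # ys = us @ [z] @ vs"
        by (intro exI[of _ "[x]"] exI[of _ y] exI[of _ ys]) simp
      then have "adds_point UNIV (x # ys) (x # y # ys)"
        using False by (simp add: adds_point_def chain)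
      then have "homotopic UNIV (x # y # ys) (x # ys)"
        using step by blast
      then show ?thesis
        using Cons.IH False homotopic_trans by force
    qed
  qed
  then show ?thesis using assms by (cases xs) auto
qed

lemma bij_betw_endpoint_UNIV: "bij_betw endpoint (points (chain_space b UNIV)) UNIV"
proof (rule bij_betwI')
  fix c d assume "c \<in> points (chain_space b UNIV)" "d \<in> points (chain_space b UNIV)"
  then obtain xs ys where "c = hclass UNIV xs" "hd xs = b" "xs \<noteq> []"
    "d = hclass UNIV ys" "hd ys = b" "ys \<noteq> []"
    by (auto simp: chain_space_def chain_def)
  then show "endpoint c = endpoint d \<longleftrightarrow> c = d"
    using homotopic_UNIV[of xs] homotopic_UNIV[of ys]
    by (metis endpoint_hclass hclass_eq_iff)
next
  fix y
  have "hclass UNIV [b, y] \<in> points (chain_space b UNIV)"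
    by (force simp: chain_space_def chain_def)
  then show "\<exists>c\<in>points (chain_space b UNIV). y = endpoint c"
    using endpoint_hclass[of UNIV "[b, y]"] by force
qed simp

definition covering_base :: "'a::uniform_space \<Rightarrow> 'a rel set" where
  "covering_base b =
     {E \<in> entourages. (\<lambda>u. u E) ` points (X_tilde b) = points (chain_space b E)}"

definition coverable :: "'a::uniform_space \<Rightarrow> bool" where
  "coverable b \<longleftrightarrow>
     (\<exists>B. uniformity_base class_uspace B \<and> UNIV \<in> B \<and>
        (\<forall>E\<in>B. (\<lambda>u. u E) ` points (X_tilde b) = points (chain_space b E)))"

end

theory Submission
  imports Defs
begin

text \<open>
  Loop classes act on classes of chains by precomposition. This action is free and preserves
  endpoints, and its orbits are the sets of classes with a common endpoint: two chains with the
  same endpoint differ by the loop that runs along one and back along the other. The uniformity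
  of a chain space is generated by single steps at the end of a chain, and such steps commute with
  precomposition. Hence the basic entourages are invariant, which makes the action isomorphic,
  and freeness makes it discrete.

  A bonding map between chain spaces is equivariant. By freeness its fibres are the orbits of the
  kernel of the homomorphism of loop groups (\<open>discrete_cover_of_equivariant\<close>). On the covering
  base the bonding maps are onto, because projections from the limit factor through them, and
  then one-step extensions lift along them (\<open>unif_chain_space_image\<close>). So they are quotient maps
  not only of sets but of uniform spaces, that is, discrete covers.

  The limit inherits an invariant base of entourages (\<open>isomorphic_action_limit\<close>). The defining
  limit runs over all entourages, whereas a prodiscrete action requires a system with surjective
  projections; coverability makes the covering base cofinal, and restricting the system to it
  changes neither the space nor the group (\<open>prodiscrete_action_limit\<close>). The fibres of
  \<open>phi\<close> are orbits since the translating loop classes are unique at each level and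
  therefore compatible (\<open>same_orbit_limit\<close>). Finally, the uniformity of \<open>X\<close> is the image of that
  of the limit (\<open>unif_class_uspace_phi\<close>): a small step in \<open>X\<close> extends a coordinate at a member of
  the covering base, and the extended class comes again from a point of the limit.
\<close>

section \<open>Uniformly continuous maps and quotients\<close>

lemma eventually_points:
  assumes "uniform_space_on X"
  shows "eventually (\<lambda>p. p \<in> points X \<times> points X) (unif X)"
  using assms by (auto simp: uniform_space_on_def le_principal)

lemma uniform_space_on_transD:
  assumes "uniform_space_on X" "eventually P (unif X)"
  shows "\<exists>Q. eventually Q (unif X) \<and> (\<forall>x y z. Q (x, y) \<longrightarrow> Q (y, z) \<longrightarrow> P (x, z))"
  using assms by (simp add: uniform_space_on_def)

lemma ucont_iff_eventually:
  "ucont X Y f \<longleftrightarrow> f \<in> points X \<rightarrow> points Y \<and>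
     (\<forall>P. eventually P (unif Y) \<longrightarrow> eventually (\<lambda>p. P (f (fst p), f (snd p))) (unif X))"
  by (simp add: ucont_def filterlim_iff case_prod_unfold)

lemma ucont_compose:
  assumes "ucont X Y f" "ucont Y Z g" shows "ucont X Z (\<lambda>x. g (f x))"
  using assms unfolding ucont_iff_eventually by fastforce

lemma ucont_cong:
  assumes "uniform_space_on X" "\<And>x. x \<in> points X \<Longrightarrow> f x = g x" "ucont X Y f"
  shows "ucont X Y g"
  unfolding ucont_iff_eventually
proof (intro conjI allI impI)
  show "g \<in> points X \<rightarrow> points Y"
    using assms(2,3) by (force simp: ucont_def)
  fix P assume "eventually P (unif Y)"
  then have "eventually (\<lambda>p. P (f (fst p), f (snd p))) (unif X)"
    using assms(3) by (simp add: ucont_iff_eventually)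
  with eventually_points[OF assms(1)]
  show "eventually (\<lambda>p. P (g (fst p), g (snd p))) (unif X)"
    by eventually_elim (auto simp: assms(2))
qed

text \<open>
  Entourages are symmetric by convention, so the relation given by \<open>P\<close> has to be symmetrised.
\<close>

lemma entourage_within:
  assumes "uniform_space_on X" "eventually P (unif X)"
  obtains E where "entourage X E" "\<And>p. p \<in> E \<Longrightarrow> P p"
proof
  define E where "E = {(x, y) \<in> points X \<times> points X. P (x, y) \<and> P (y, x)}"
  have "eventually (\<lambda>(x, y). P (y, x)) (unif X)"
    using assms by (simp add: uniform_space_on_def)
  with eventually_points[OF assms(1)] assms(2)
  have "eventually (\<lambda>p. p \<in> E) (unif X)"
    by eventually_elim (auto simp: E_def)
  then show "entourage X E"
    by (auto simp: entourage_def E_def sym_def)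
  show "P p" if "p \<in> E" for p
    using that by (auto simp: E_def)
qed

text \<open>
  Inverse elements act as inverse maps, so every element acts bijectively.
\<close>

lemma group_actionI:
  assumes "group G"
    and closed: "\<And>g x. g \<in> carrier G \<Longrightarrow> x \<in> S \<Longrightarrow> act g x \<in> S"
    and ext: "\<And>g. g \<in> carrier G \<Longrightarrow> act g \<in> extensional S"
    and one: "\<And>x. x \<in> S \<Longrightarrow> act \<one>\<^bsub>G\<^esub> x = x"
    and mult: "\<And>g h x. g \<in> carrier G \<Longrightarrow> h \<in> carrier G \<Longrightarrow> x \<in> S \<Longrightarrow>
                 act (g \<otimes>\<^bsub>G\<^esub> h) x = act g (act h x)"
  shows "group_action G S act"
proof -
  interpret group G by fact
  have Bij: "act g \<in> Bij S" if g: "g \<in> carrier G" for g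
  proof -
    have "act (inv\<^bsub>G\<^esub> g) (act g x) = x" "act g (act (inv\<^bsub>G\<^esub> g) x) = x" if "x \<in> S" for x
      using mult[of "inv\<^bsub>G\<^esub> g" g x] mult[of g "inv\<^bsub>G\<^esub> g" x] one that g by simp_all
    then have "bij_betw (act g) S S"
      using closed g by (intro bij_betwI[where g = "act (inv\<^bsub>G\<^esub> g)"]) auto
    then show ?thesis using ext[OF g] by (simp add: Bij_def)
  qed
  have "act \<in> hom G (BijGroup S)"
    unfolding hom_def
  proof (intro CollectI conjI ballI)
    show "act \<in> carrier G \<rightarrow> carrier (BijGroup S)"
      using Bij by (simp add: BijGroup_def)
    fix g h assume gh: "g \<in> carrier G" "h \<in> carrier G"
    have "act (g \<otimes>\<^bsub>G\<^esub> h) = compose S (act g) (act h)"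
      using gh mult ext[of "g \<otimes>\<^bsub>G\<^esub> h"]
      by (intro extensionalityI[where A = S]) (auto simp: compose_def)
    then show "act (g \<otimes>\<^bsub>G\<^esub> h) = act g \<otimes>\<^bsub>BijGroup S\<^esub> act h"
      using gh Bij by (simp add: BijGroup_def)
  qed
  then show ?thesis
    by (simp add: group_action_def group_hom_def group_hom_axioms_def group_BijGroup assms(1))
qed

lemma group_action_is_group: "group_action G S act \<Longrightarrow> group G"
  by (simp add: group_action_def group_hom_def)

lemma group_action_subgroup:
  assumes "group_action G S act" "subgroup H G"
  shows "group_action (G\<lparr>carrier := H\<rparr>) S act"
proof -
  have "group_hom G (BijGroup S) act"
    using assms(1) by (simp add: group_action_def)
  then show ?thesis
    using assms(2) subgroup.subgroup_is_group[OF assms(2)] subgroup.subset[OF assms(2)]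
    by (auto simp: group_action_def group_hom_def group_hom_axioms_def hom_def)
qed

text \<open>
  The inverse of the map given by \<open>g\<close> is the map given by \<open>g\<close>'s inverse, so uniform
  continuity of all the maps makes each of them a uniform homeomorphism.
\<close>

lemma uniform_actionI:
  assumes "uniform_space_on X" "group_action G (points X) act"
    and uc: "\<And>g. g \<in> carrier G \<Longrightarrow> ucont X X (act g)"
  shows "uniform_action G X act"
  unfolding uniform_action_def
proof (intro conjI ballI)
  interpret A: group_action G "points X" act by fact
  interpret G: group G using assms(2) by (rule group_action_is_group)
  fix g assume g: "g \<in> carrier G"
  have bij: "bij_betw (act g) (points X) (points X)"
    using A.bij_prop0[OF g] by (simp add: Bij_def)
  have "act (inv\<^bsub>G\<^esub> g) y = inv_into (points X) (act g) y" if "y \<in> points X" for y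
  proof -
    have "inv_into (points X) (act g) y \<in> points X" "act g (inv_into (points X) (act g) y) = y"
      using bij that by (auto simp: bij_betw_def inv_into_into f_inv_into_f)
    then show ?thesis using A.orbit_sym_aux[OF g] by blast
  qed
  then have "ucont X X (inv_into (points X) (act g))"
    using ucont_cong[OF assms(1) _ uc] g by (metis G.inv_closed)
  with bij uc[OF g] show "uhomeo X X (act g)" by (simp add: uhomeo_def)
qed fact+

text \<open>
  Applied to the inverse of \<open>g\<close>, the inclusion of the image in \<open>W\<close> is the reverse
  inclusion for \<open>g\<close>.
\<close>

lemma invariantI:
  assumes "group_action G S act" "W \<subseteq> S \<times> S"
    and sub: "\<And>g x y. g \<in> carrier G \<Longrightarrow> (x, y) \<in> W \<Longrightarrow> (act g x, act g y) \<in> W"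
    and g: "g \<in> carrier G"
  shows "map_prod (act g) (act g) ` W = W"
proof
  interpret A: group_action G S act by fact
  interpret G: group G using assms(1) by (rule group_action_is_group)
  show "map_prod (act g) (act g) ` W \<subseteq> W" using sub g by auto
  show "W \<subseteq> map_prod (act g) (act g) ` W"
  proof safe
    fix x y assume xy: "(x, y) \<in> W"
    have canc: "act g (act (inv\<^bsub>G\<^esub> g) z) = z" if "z \<in> S" for z
      using A.orbit_sym_aux[of "inv\<^bsub>G\<^esub> g" z] that g by simp
    have "(x, y) = map_prod (act g) (act g) (act (inv\<^bsub>G\<^esub> g) x, act (inv\<^bsub>G\<^esub> g) y)"
      using xy assms(2) canc by auto
    then show "(x, y) \<in> map_prod (act g) (act g) ` W"
      using sub[OF _ xy, of "inv\<^bsub>G\<^esub> g"] g by blast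
  qed
qed

text \<open>
  The quotient uniformity is the image filter along the orbit map. If the fibres of \<open>f\<close>
  are the orbits and the uniformity of \<open>Y\<close> is the image filter along \<open>f\<close>, then the
  bijection between orbits and values of \<open>f\<close> matches the two filters exactly.
\<close>

lemma quotient_map_upto_uhomeoI:
  assumes X: "uniform_space_on X" and A: "group_action G (points X) act"
    and surj: "f ` points X = points Y"
    and unif: "unif Y = filtermap (\<lambda>(x, y). (f x, f y)) (unif X)"
    and fibre: "\<And>x y. x \<in> points X \<Longrightarrow> y \<in> points X \<Longrightarrow> f x = f y \<longleftrightarrow> y \<in> orbit G act x"
  shows "quotient_map_upto_uhomeo G act X Y f"
proof -
  interpret A: group_action G "points X" act by fact
  let ?Q = "quotient_uspace G X act"
  let ?orb = "orbit G act"
  define k where "k c = f (SOME x. x \<in> c)" for c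
  have orb_sub: "?orb x \<subseteq> points X" if "x \<in> points X" for x
    using that A.element_image by (auto simp: orbit_def)
  have k: "k (?orb x) = f x" if x: "x \<in> points X" for x
  proof -
    have "(SOME z. z \<in> ?orb x) \<in> ?orb x"
      using A.orbit_refl[OF x] by (rule someI)
    then show ?thesis
      using fibre[OF x, of "SOME z. z \<in> ?orb x"] orb_sub[OF x] by (simp add: k_def subset_iff)
  qed
  have eq: "?orb x = ?orb y" if "x \<in> points X" "y \<in> points X" "f x = f y" for x y
  proof -
    have "z \<in> ?orb x \<longleftrightarrow> z \<in> ?orb y" for z
      using fibre[of x z] fibre[of y z] that orb_sub[of x] orb_sub[of y] by auto
    then show ?thesis by blast
  qed
  have pts: "points ?Q = ?orb ` points X"
    by (auto simp: quotient_uspace_def orbits_def)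
  have bij: "bij_betw k (points ?Q) (points Y)"
    unfolding bij_betw_def
  proof
    show "inj_on k (points ?Q)"
    proof (rule inj_onI)
      fix c d assume cd: "c \<in> points ?Q" "d \<in> points ?Q" "k c = k d"
      then obtain x y where xy: "c = ?orb x" "x \<in> points X" "d = ?orb y" "y \<in> points X"
        unfolding pts by blast
      have "f x = f y" using cd(3) k[OF xy(2)] k[OF xy(4)] by (simp add: xy(1,3))
      then show "c = d" using eq[OF xy(2,4)] by (simp only: xy(1,3))
    qed
    show "k ` points ?Q = points Y"
      unfolding pts image_image surj[symmetric] by (rule image_cong[OF refl k])
  qed
  have ev_Y: "eventually P (unif Y) \<longleftrightarrow> eventually (\<lambda>p. P (f (fst p), f (snd p))) (unif X)" for P
    by (simp add: unif eventually_filtermap case_prod_unfold)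
  have ev_Q: "eventually P (unif ?Q) \<longleftrightarrow> eventually (\<lambda>p. P (?orb (fst p), ?orb (snd p))) (unif X)" for P
    by (simp add: quotient_uspace_def eventually_filtermap case_prod_unfold)
  have "ucont ?Q Y k"
    unfolding ucont_iff_eventually ev_Y ev_Q
  proof (intro conjI allI impI)
    show "k \<in> points ?Q \<rightarrow> points Y"
      using bij by (auto simp: bij_betw_def)
    fix P assume "eventually (\<lambda>p. P (f (fst p), f (snd p))) (unif X)"
    with eventually_points[OF X]
    show "eventually (\<lambda>p. P (k (fst (?orb (fst p), ?orb (snd p))),
                              k (snd (?orb (fst p), ?orb (snd p))))) (unif X)"
      by eventually_elim (auto simp: k)
  qed
  moreover have "ucont Y ?Q (inv_into (points ?Q) k)"
    unfolding ucont_iff_eventually ev_Y ev_Q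
  proof (intro conjI allI impI)
    show "inv_into (points ?Q) k \<in> points Y \<rightarrow> points ?Q"
      using bij_betw_inv_into[OF bij] by (auto simp: bij_betw_def)
    have inv: "inv_into (points ?Q) k (f x) = ?orb x" if "x \<in> points X" for x
      using bij that k[OF that] by (intro inv_into_f_eq) (auto simp: bij_betw_def pts)
    fix P assume "eventually (\<lambda>p. P (?orb (fst p), ?orb (snd p))) (unif X)"
    with eventually_points[OF X]
    show "eventually (\<lambda>p. P (inv_into (points ?Q) k (fst (f (fst p), f (snd p))),
                              inv_into (points ?Q) k (snd (f (fst p), f (snd p))))) (unif X)"
      by eventually_elim (auto simp: inv)
  qed
  ultimately show ?thesis
    using bij k unfolding quotient_map_upto_uhomeo_def uhomeo_def by auto
qed

text \<open>
  The covering group is the kernel of \<open>h\<close>. If \<open>g\<close> carries a point \<open>x\<close> to another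
  point of its fibre, then equivariance shows that \<open>h g\<close> fixes \<open>f x\<close>, and freeness of the
  action downstairs puts \<open>g\<close> into the kernel. So the fibres of \<open>f\<close> are the orbits of the
  kernel, and a subgroup of a discretely and isomorphically acting group acts so, too.
\<close>

lemma discrete_cover_of_equivariant:
  fixes X :: "'x uspace" and G :: "'x monoid"
  assumes dis: "discrete_action G X act" and iso: "isomorphic_action G X act"
    and H: "group H" "h \<in> hom G H"
    and equi: "\<And>g x. g \<in> carrier G \<Longrightarrow> x \<in> points X \<Longrightarrow> f (act g x) = actY (h g) (f x)"
    and one: "\<And>y. y \<in> points Y \<Longrightarrow> actY \<one>\<^bsub>H\<^esub> y = y"
    and free: "\<And>k y. k \<in> carrier H \<Longrightarrow> y \<in> points Y \<Longrightarrow> actY k y = y \<Longrightarrow> k = \<one>\<^bsub>H\<^esub>"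
    and surj: "f ` points X = points Y"
    and unif: "unif Y = filtermap (\<lambda>(x, y). (f x, f y)) (unif X)"
    and trans: "\<And>x y. x \<in> points X \<Longrightarrow> y \<in> points X \<Longrightarrow> f x = f y \<Longrightarrow> \<exists>g\<in>carrier G. act g x = y"
  shows "discrete_cover X Y f"
proof -
  let ?K = "kernel G H h"
  let ?GK = "G\<lparr>carrier := ?K\<rparr>"
  have U: "uniform_space_on X" and A: "group_action G (points X) act"
    and uh: "\<And>g. g \<in> carrier G \<Longrightarrow> uhomeo X X (act g)"
    using dis by (auto simp: discrete_action_def uniform_action_def)
  have "group_hom G H h"
    using group_action_is_group[OF A] H by (simp add: group_hom_def group_hom_axioms_def)
  then have AK: "group_action ?GK (points X) act"
    using group_action_subgroup[OF A] group_hom.subgroup_kernel by blast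
  have sub: "g \<in> carrier G" if "g \<in> ?K" for g
    using that by (simp add: kernel_def)
  have UK: "uniform_action ?GK X act"
    using U AK uh sub by (auto simp: uniform_action_def)
  have "discrete_action ?GK X act"
    unfolding discrete_action_def using UK dis sub by (fastforce simp: discrete_action_def)
  moreover have "isomorphic_action ?GK X act"
    unfolding isomorphic_action_def using UK iso sub by (fastforce simp: isomorphic_action_def)
  moreover have "quotient_map_upto_uhomeo ?GK act X Y f"
  proof (rule quotient_map_upto_uhomeoI[OF U AK surj unif])
    fix x y assume xy: "x \<in> points X" "y \<in> points X"
    show "f x = f y \<longleftrightarrow> y \<in> orbit ?GK act x"
    proof
      assume fxy: "f x = f y"
      then obtain g where g: "g \<in> carrier G" "act g x = y" using trans xy by blast
      have "actY (h g) (f x) = f x" using equi g xy fxy by metis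
      then have "h g = \<one>\<^bsub>H\<^esub>"
        using free[of "h g" "f x"] g H(2) xy surj by (auto simp: hom_def)
      then show "y \<in> orbit ?GK act x"
        using g by (auto simp: orbit_def kernel_def)
    next
      assume "y \<in> orbit ?GK act x"
      then obtain g where "g \<in> carrier G" "h g = \<one>\<^bsub>H\<^esub>" "y = act g x"
        by (auto simp: orbit_def kernel_def)
      moreover have "f x \<in> points Y" using xy surj by blast
      ultimately show "f x = f y" using equi one xy by simp
    qed
  qed
  ultimately show ?thesis unfolding discrete_cover_def by blast
qed


section \<open>Inverse limits of spaces, groups and actions\<close>

lemma threads_iff:
  "u \<in> threads I le_idx S f \<longleftrightarrow> u \<in> extensional I \<and> (\<forall>\<alpha>\<in>I. u \<alpha> \<in> S \<alpha>) \<and>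
     (\<forall>\<alpha>\<in>I. \<forall>\<beta>\<in>I. le_idx \<alpha> \<beta> \<longrightarrow> f \<alpha> \<beta> (u \<beta>) = u \<alpha>)"
  by (auto simp: threads_def PiE_iff)

lemma points_inverse_limit:
  "points (inverse_limit_uspace I le_idx X f) = threads I le_idx (\<lambda>\<alpha>. points (X \<alpha>)) f"
  by (simp add: inverse_limit_uspace_def Let_def)

lemma carrier_inverse_limit:
  "carrier (inverse_limit_group I le_idx G h) = threads I le_idx (\<lambda>\<alpha>. carrier (G \<alpha>)) h"
  by (simp add: inverse_limit_group_def)

lemma mult_inverse_limit:
  "x \<otimes>\<^bsub>inverse_limit_group I le_idx G h\<^esub> y = (\<lambda>\<alpha>\<in>I. x \<alpha> \<otimes>\<^bsub>G \<alpha>\<^esub> y \<alpha>)"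
  by (simp add: inverse_limit_group_def product_group_def)

lemma one_inverse_limit: "\<one>\<^bsub>inverse_limit_group I le_idx G h\<^esub> = (\<lambda>\<alpha>\<in>I. \<one>\<^bsub>G \<alpha>\<^esub>)"
  by (simp add: inverse_limit_group_def product_group_def)

text \<open>
  Since the index set is directed, one coordinate suffices to describe an entourage of the
  limit: on threads, the coordinates at \<open>\<alpha>\<close> and \<open>\<beta>\<close> are uniformly continuous functions of the
  coordinate at any index beyond both. The filter on all pairs of families has no such base, so
  the principal filter of pairs of threads is moved inside the infimum.
\<close>

lemma eventually_inverse_limit:
  assumes S: "uspace_inverse_system I le_idx X f"
  shows "eventually P (unif (inverse_limit_uspace I le_idx X f)) \<longleftrightarrow>
     (\<exists>\<alpha>\<in>I. \<exists>Q. eventually Q (unif (X \<alpha>)) \<and>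
        (\<forall>u\<in>points (inverse_limit_uspace I le_idx X f). \<forall>v\<in>points (inverse_limit_uspace I le_idx X f).
           Q (u \<alpha>, v \<alpha>) \<longrightarrow> P (u, v)))"
proof -
  let ?L = "threads I le_idx (\<lambda>\<alpha>. points (X \<alpha>)) f"
  define F where "F \<alpha> = inf (principal (?L \<times> ?L)) (filtercomap (\<lambda>(u, v). (u \<alpha>, v \<alpha>)) (unif (X \<alpha>)))" for \<alpha>
  have dir: "directed_set I le_idx" using S by (simp add: uspace_inverse_system_def)
  then have ne: "I \<noteq> {}" by (simp add: directed_set_def)
  have ev_F: "eventually P (F \<alpha>) \<longleftrightarrow>
      (\<exists>Q. eventually Q (unif (X \<alpha>)) \<and> (\<forall>u\<in>?L. \<forall>v\<in>?L. Q (u \<alpha>, v \<alpha>) \<longrightarrow> P (u, v)))" for P \<alpha>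
    unfolding F_def inf_commute[of "principal _"] eventually_inf_principal eventually_filtercomap
    by (intro ex_cong1) auto
  have mono: "F \<beta> \<le> F \<alpha>" if "\<alpha> \<in> I" "\<beta> \<in> I" "le_idx \<alpha> \<beta>" for \<alpha> \<beta>
  proof (rule filter_leI)
    fix P assume "eventually P (F \<alpha>)"
    then obtain Q where Q: "eventually Q (unif (X \<alpha>))"
      "\<forall>u\<in>?L. \<forall>v\<in>?L. Q (u \<alpha>, v \<alpha>) \<longrightarrow> P (u, v)"
      unfolding ev_F by blast
    have "ucont (X \<beta>) (X \<alpha>) (f \<alpha> \<beta>)"
      using S that by (simp add: uspace_inverse_system_def)
    with Q(1) have "eventually (\<lambda>p. Q (f \<alpha> \<beta> (fst p), f \<alpha> \<beta> (snd p))) (unif (X \<beta>))"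
      by (simp add: ucont_iff_eventually)
    moreover have "\<forall>u\<in>?L. \<forall>v\<in>?L. Q (f \<alpha> \<beta> (u \<beta>), f \<alpha> \<beta> (v \<beta>)) \<longrightarrow> P (u, v)"
      using Q(2) that by (auto simp: threads_iff)
    ultimately show "eventually P (F \<beta>)"
      unfolding ev_F by (intro exI[of _ "\<lambda>p. Q (f \<alpha> \<beta> (fst p), f \<alpha> \<beta> (snd p))"]) simp
  qed
  have "unif (inverse_limit_uspace I le_idx X f) = (INF \<alpha>\<in>I. F \<alpha>)"
    unfolding F_def inverse_limit_uspace_def Let_def uspace.simps
    by (rule INF_inf_const1[OF ne, symmetric])
  moreover have "eventually P (INF \<alpha>\<in>I. F \<alpha>) \<longleftrightarrow> (\<exists>\<alpha>\<in>I. eventually P (F \<alpha>))"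
  proof (rule eventually_INF_base[OF ne])
    fix \<alpha> \<beta> assume "\<alpha> \<in> I" "\<beta> \<in> I"
    then obtain \<gamma> where "\<gamma> \<in> I" "le_idx \<alpha> \<gamma>" "le_idx \<beta> \<gamma>"
      using dir unfolding directed_set_def by blast
    then show "\<exists>\<gamma>\<in>I. F \<gamma> \<le> inf (F \<alpha>) (F \<beta>)"
      using mono \<open>\<alpha> \<in> I\<close> \<open>\<beta> \<in> I\<close> by auto
  qed
  ultimately show ?thesis by (simp only: ev_F points_inverse_limit)
qed

lemma uniform_space_on_inverse_limit:
  assumes S: "uspace_inverse_system I le_idx X f"
  shows "uniform_space_on (inverse_limit_uspace I le_idx X f)"
  unfolding uniform_space_on_def
proof (intro conjI allI impI ballI)
  let ?L = "inverse_limit_uspace I le_idx X f"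
  have X: "uniform_space_on (X \<alpha>)" if "\<alpha> \<in> I" for \<alpha>
    using S that by (simp add: uspace_inverse_system_def)
  show "unif ?L \<le> principal (points ?L \<times> points ?L)"
    by (simp add: inverse_limit_uspace_def Let_def)
  fix P assume "eventually P (unif ?L)"
  then obtain \<alpha> Q where Q: "\<alpha> \<in> I" "eventually Q (unif (X \<alpha>))"
    "\<And>u v. u \<in> points ?L \<Longrightarrow> v \<in> points ?L \<Longrightarrow> Q (u \<alpha>, v \<alpha>) \<Longrightarrow> P (u, v)"
    unfolding eventually_inverse_limit[OF S] by blast
  have X\<alpha>: "\<And>P x. eventually P (unif (X \<alpha>)) \<Longrightarrow> x \<in> points (X \<alpha>) \<Longrightarrow> P (x, x)"
    "\<And>P. eventually P (unif (X \<alpha>)) \<Longrightarrow> eventually (\<lambda>(x, y). P (y, x)) (unif (X \<alpha>))"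
    "\<And>P. eventually P (unif (X \<alpha>)) \<Longrightarrow>
       \<exists>R. eventually R (unif (X \<alpha>)) \<and> (\<forall>x y z. R (x, y) \<longrightarrow> R (y, z) \<longrightarrow> P (x, z))"
    using X[OF Q(1)] unfolding uniform_space_on_def by blast+
  show "P (u, u)" if "u \<in> points ?L" for u
    using that Q(3)[of u u] X\<alpha>(1)[OF Q(2)] Q(1) by (simp add: points_inverse_limit threads_iff)
  show "eventually (\<lambda>(x, y). P (y, x)) (unif ?L)"
    unfolding eventually_inverse_limit[OF S]
    using Q(1,3) X\<alpha>(2)[OF Q(2)] by (intro bexI[of _ \<alpha>] exI[of _ "\<lambda>(x, y). Q (y, x)"]) auto
  obtain R where R: "eventually R (unif (X \<alpha>))" "\<And>x y z. R (x, y) \<Longrightarrow> R (y, z) \<Longrightarrow> Q (x, z)"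
    using X\<alpha>(3)[OF Q(2)] by blast
  define T where "T = (\<lambda>(u, v). u \<in> points ?L \<and> v \<in> points ?L \<and> R (u \<alpha>, v \<alpha>))"
  have "eventually T (unif ?L)"
    unfolding eventually_inverse_limit[OF S] using Q(1) R(1) by (auto simp: T_def)
  moreover have "\<forall>x y z. T (x, y) \<longrightarrow> T (y, z) \<longrightarrow> P (x, z)"
    using R(2) Q(3) by (auto simp: T_def)
  ultimately show "\<exists>T. eventually T (unif ?L) \<and> (\<forall>x y z. T (x, y) \<longrightarrow> T (y, z) \<longrightarrow> P (x, z))"
    by blast
qed

lemma ucont_limit_projection:
  assumes S: "uspace_inverse_system I le_idx X f" and \<alpha>: "\<alpha> \<in> I"
  shows "ucont (inverse_limit_uspace I le_idx X f) (X \<alpha>) (\<lambda>u. u \<alpha>)"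
  unfolding ucont_iff_eventually eventually_inverse_limit[OF S]
  using \<alpha> by (auto simp: points_inverse_limit threads_iff)

text \<open>
  The universal property of the limit uniformity.
\<close>

lemma ucont_into_limit:
  assumes S: "uspace_inverse_system I le_idx X f" and Z: "uniform_space_on Z"
    and p: "p \<in> points Z \<rightarrow> points (inverse_limit_uspace I le_idx X f)"
    and coord: "\<And>\<alpha>. \<alpha> \<in> I \<Longrightarrow> ucont Z (X \<alpha>) (\<lambda>z. p z \<alpha>)"
  shows "ucont Z (inverse_limit_uspace I le_idx X f) p"
  unfolding ucont_iff_eventually
proof (intro conjI allI impI)
  fix P assume "eventually P (unif (inverse_limit_uspace I le_idx X f))"
  then obtain \<alpha> Q where Q: "\<alpha> \<in> I" "eventually Q (unif (X \<alpha>))"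
    "\<And>u v. u \<in> points (inverse_limit_uspace I le_idx X f) \<Longrightarrow>
       v \<in> points (inverse_limit_uspace I le_idx X f) \<Longrightarrow> Q (u \<alpha>, v \<alpha>) \<Longrightarrow> P (u, v)"
    unfolding eventually_inverse_limit[OF S] by blast
  have "eventually (\<lambda>z. Q (p (fst z) \<alpha>, p (snd z) \<alpha>)) (unif Z)"
    using coord[OF Q(1)] Q(2) by (simp add: ucont_iff_eventually)
  with eventually_points[OF Z] show "eventually (\<lambda>z. P (p (fst z), p (snd z))) (unif Z)"
    by eventually_elim (use funcset_mem[OF p] Q(3) in auto)
qed (fact p)

lemma group_inverse_limit:
  assumes S: "group_inverse_system I le_idx G h"
  shows "group (inverse_limit_group I le_idx G h)"
proof -
  have grp: "\<And>\<alpha>. \<alpha> \<in> I \<Longrightarrow> group (G \<alpha>)"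
    and hom: "\<And>\<alpha> \<beta>. \<alpha> \<in> I \<Longrightarrow> \<beta> \<in> I \<Longrightarrow> le_idx \<alpha> \<beta> \<Longrightarrow> group_hom (G \<beta>) (G \<alpha>) (h \<alpha> \<beta>)"
    using S by (auto simp: group_inverse_system_def group_hom_def group_hom_axioms_def)
  let ?T = "threads I le_idx (\<lambda>\<alpha>. carrier (G \<alpha>)) h"
  interpret P: group "product_group I G" using grp by simp
  have "subgroup ?T (product_group I G)"
  proof (rule P.subgroupI)
    show "?T \<subseteq> carrier (product_group I G)"
      by (auto simp: threads_def)
    have "(\<lambda>\<alpha>\<in>I. \<one>\<^bsub>G \<alpha>\<^esub>) \<in> ?T"
      using grp hom by (auto simp: threads_iff group_hom.hom_one group.is_monoid)
    then show "?T \<noteq> {}" by blast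
    show "inv\<^bsub>product_group I G\<^esub> u \<in> ?T" if "u \<in> ?T" for u
    proof -
      have u: "\<And>\<alpha>. \<alpha> \<in> I \<Longrightarrow> u \<alpha> \<in> carrier (G \<alpha>)"
        "\<And>\<alpha> \<beta>. \<alpha> \<in> I \<Longrightarrow> \<beta> \<in> I \<Longrightarrow> le_idx \<alpha> \<beta> \<Longrightarrow> h \<alpha> \<beta> (u \<beta>) = u \<alpha>"
        using that by (auto simp: threads_iff)
      have "inv\<^bsub>product_group I G\<^esub> u = (\<lambda>\<alpha>\<in>I. inv\<^bsub>G \<alpha>\<^esub> (u \<alpha>))"
        using that grp by (intro inv_product_group) (auto simp: threads_def)
      moreover have "h \<alpha> \<beta> (inv\<^bsub>G \<beta>\<^esub> (u \<beta>)) = inv\<^bsub>G \<alpha>\<^esub> (u \<alpha>)"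
        if "\<alpha> \<in> I" "\<beta> \<in> I" "le_idx \<alpha> \<beta>" for \<alpha> \<beta>
        using group_hom.hom_inv[OF hom[OF that] u(1)[OF that(2)]] u(2)[OF that] by simp
      ultimately show ?thesis
        using u(1) grp by (auto simp: threads_iff)
    qed
    show "u \<otimes>\<^bsub>product_group I G\<^esub> v \<in> ?T" if "u \<in> ?T" "v \<in> ?T" for u v
    proof -
      have uv: "\<And>\<alpha>. \<alpha> \<in> I \<Longrightarrow> u \<alpha> \<in> carrier (G \<alpha>)" "\<And>\<alpha>. \<alpha> \<in> I \<Longrightarrow> v \<alpha> \<in> carrier (G \<alpha>)"
        "\<And>\<alpha> \<beta>. \<alpha> \<in> I \<Longrightarrow> \<beta> \<in> I \<Longrightarrow> le_idx \<alpha> \<beta> \<Longrightarrow> h \<alpha> \<beta> (u \<beta>) = u \<alpha>"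
        "\<And>\<alpha> \<beta>. \<alpha> \<in> I \<Longrightarrow> \<beta> \<in> I \<Longrightarrow> le_idx \<alpha> \<beta> \<Longrightarrow> h \<alpha> \<beta> (v \<beta>) = v \<alpha>"
        using that by (auto simp: threads_iff)
      have "h \<alpha> \<beta> (u \<beta> \<otimes>\<^bsub>G \<beta>\<^esub> v \<beta>) = u \<alpha> \<otimes>\<^bsub>G \<alpha>\<^esub> v \<alpha>"
        if "\<alpha> \<in> I" "\<beta> \<in> I" "le_idx \<alpha> \<beta>" for \<alpha> \<beta>
        using group_hom.hom_mult[OF hom[OF that], of "u \<beta>" "v \<beta>"] uv that by simp
      then show ?thesis
        using uv(1,2) grp by (auto simp: threads_iff monoid.m_closed group.is_monoid)
    qed
  qed
  then show ?thesis
    unfolding inverse_limit_group_def by (rule P.subgroup_imp_group)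
qed

definition limit_act ::
    "'i set \<Rightarrow> ('i \<Rightarrow> 'i \<Rightarrow> bool) \<Rightarrow> ('i \<Rightarrow> 'x uspace) \<Rightarrow> ('i \<Rightarrow> 'i \<Rightarrow> 'x \<Rightarrow> 'x) \<Rightarrow>
     ('i \<Rightarrow> 'g \<Rightarrow> 'x \<Rightarrow> 'x) \<Rightarrow> ('i \<Rightarrow> 'g) \<Rightarrow> ('i \<Rightarrow> 'x) \<Rightarrow> ('i \<Rightarrow> 'x)" where
  "limit_act I le_idx X f act g =
     (\<lambda>u\<in>points (inverse_limit_uspace I le_idx X f). \<lambda>\<alpha>\<in>I. act \<alpha> (g \<alpha>) (u \<alpha>))"

lemma limit_act_coord:
  "u \<in> points (inverse_limit_uspace I le_idx X f) \<Longrightarrow> \<alpha> \<in> I \<Longrightarrow>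
     limit_act I le_idx X f act g u \<alpha> = act \<alpha> (g \<alpha>) (u \<alpha>)"
  by (simp add: limit_act_def)

context
  fixes I :: "'i set" and le_idx and X :: "'i \<Rightarrow> 'x uspace" and f
    and G :: "'i \<Rightarrow> 'g monoid" and h act L GL actL
  assumes S: "uspace_inverse_system I le_idx X f"
    and SG: "group_inverse_system I le_idx G h"
    and equi: "equivariant_bonds I le_idx X f G h act"
    and ua: "\<And>\<alpha>. \<alpha> \<in> I \<Longrightarrow> uniform_action (G \<alpha>) (X \<alpha>) (act \<alpha>)"
  defines "L \<equiv> inverse_limit_uspace I le_idx X f"
    and "GL \<equiv> inverse_limit_group I le_idx G h"
    and "actL \<equiv> limit_act I le_idx X f act"
begin

private lemma L_threads: "points L = threads I le_idx (\<lambda>\<alpha>. points (X \<alpha>)) f"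
  by (simp add: L_def points_inverse_limit)

private lemma GL_threads: "carrier GL = threads I le_idx (\<lambda>\<alpha>. carrier (G \<alpha>)) h"
  by (simp add: GL_def carrier_inverse_limit)

private lemma ga: "\<alpha> \<in> I \<Longrightarrow> group_action (G \<alpha>) (points (X \<alpha>)) (act \<alpha>)"
  using ua by (simp add: uniform_action_def)

private lemma actL_coord: "u \<in> points L \<Longrightarrow> \<alpha> \<in> I \<Longrightarrow> actL g u \<alpha> = act \<alpha> (g \<alpha>) (u \<alpha>)"
  by (simp add: limit_act_def actL_def L_def)

private lemma actL_closed:
  assumes "g \<in> carrier GL" "u \<in> points L" shows "actL g u \<in> points L"
  unfolding L_threads threads_iff
proof (intro conjI ballI impI)
  show "actL g u \<in> extensional I"
    using assms(2) by (simp add: actL_def L_def limit_act_def)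
  have g: "\<And>\<alpha>. \<alpha> \<in> I \<Longrightarrow> g \<alpha> \<in> carrier (G \<alpha>)"
    "\<And>\<alpha> \<beta>. \<alpha> \<in> I \<Longrightarrow> \<beta> \<in> I \<Longrightarrow> le_idx \<alpha> \<beta> \<Longrightarrow> h \<alpha> \<beta> (g \<beta>) = g \<alpha>"
    using assms(1) by (auto simp: GL_threads threads_iff)
  have u: "\<And>\<alpha>. \<alpha> \<in> I \<Longrightarrow> u \<alpha> \<in> points (X \<alpha>)"
    "\<And>\<alpha> \<beta>. \<alpha> \<in> I \<Longrightarrow> \<beta> \<in> I \<Longrightarrow> le_idx \<alpha> \<beta> \<Longrightarrow> f \<alpha> \<beta> (u \<beta>) = u \<alpha>"
    using assms(2) by (auto simp: L_threads threads_iff)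
  fix \<alpha> assume \<alpha>: "\<alpha> \<in> I"
  show "actL g u \<alpha> \<in> points (X \<alpha>)"
    using group_action.element_image[OF ga[OF \<alpha>] g(1)[OF \<alpha>] u(1)[OF \<alpha>] refl]
    by (simp add: actL_coord[OF assms(2) \<alpha>])
  fix \<beta> assume "\<beta> \<in> I" "le_idx \<alpha> \<beta>"
  then show "f \<alpha> \<beta> (actL g u \<beta>) = actL g u \<alpha>"
    using equi \<alpha> g u by (simp add: actL_coord[OF assms(2)] equivariant_bonds_def)
qed

private lemma group_action_limit: "group_action GL (points L) actL"
proof (rule group_actionI)
  show "group GL" unfolding GL_def by (rule group_inverse_limit[OF SG])
  show "actL g u \<in> points L" if "g \<in> carrier GL" "u \<in> points L" for g u
    using that by (rule actL_closed)
  show "actL g \<in> extensional (points L)" for g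
    by (simp add: actL_def L_def limit_act_def)
  have GL1: "\<one>\<^bsub>GL\<^esub> = (\<lambda>\<alpha>\<in>I. \<one>\<^bsub>G \<alpha>\<^esub>)" by (simp add: GL_def one_inverse_limit)
  show "actL \<one>\<^bsub>GL\<^esub> u = u" if u: "u \<in> points L" for u
  proof (rule extensionalityI[where A = I])
    show "u \<in> extensional I" using u by (simp add: L_threads threads_iff)
    show "actL \<one>\<^bsub>GL\<^esub> u \<in> extensional I"
      using u by (simp add: actL_def L_def limit_act_def)
    fix \<alpha> assume \<alpha>: "\<alpha> \<in> I"
    have "u \<alpha> \<in> points (X \<alpha>)" using u \<alpha> by (simp add: L_threads threads_iff)
    then show "actL \<one>\<^bsub>GL\<^esub> u \<alpha> = u \<alpha>"
      using fun_cong[OF group_action.id_eq_one[OF ga[OF \<alpha>]], of "u \<alpha>"] \<alpha>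
      by (simp add: actL_coord[OF u] GL1)
  qed
  show "actL (g \<otimes>\<^bsub>GL\<^esub> k) u = actL g (actL k u)"
    if g: "g \<in> carrier GL" and k: "k \<in> carrier GL" and u: "u \<in> points L" for g k u
  proof (rule extensionalityI[where A = I])
    note ku = actL_closed[OF k u]
    show "actL (g \<otimes>\<^bsub>GL\<^esub> k) u \<in> extensional I" "actL g (actL k u) \<in> extensional I"
      using u ku by (simp_all add: actL_def L_def limit_act_def)
    fix \<alpha> assume \<alpha>: "\<alpha> \<in> I"
    have "u \<alpha> \<in> points (X \<alpha>)" "g \<alpha> \<in> carrier (G \<alpha>)" "k \<alpha> \<in> carrier (G \<alpha>)"
      using u g k \<alpha> by (simp_all add: L_threads GL_threads threads_iff)
    then show "actL (g \<otimes>\<^bsub>GL\<^esub> k) u \<alpha> = actL g (actL k u) \<alpha>"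
      using group_action.composition_rule[OF ga[OF \<alpha>]] \<alpha>
      by (simp add: actL_coord[OF u] actL_coord[OF ku] GL_def mult_inverse_limit)
  qed
qed

private lemma U: "uniform_space_on L"
  unfolding L_def by (rule uniform_space_on_inverse_limit[OF S])

lemma uniform_action_limit: "uniform_action GL L actL"
proof (rule uniform_actionI[OF U group_action_limit])
  fix g assume g: "g \<in> carrier GL"
  show "ucont L L (actL g)"
    unfolding L_def
  proof (rule ucont_into_limit[OF S])
    show "uniform_space_on (inverse_limit_uspace I le_idx X f)" using U by (simp add: L_def)
    show "actL g \<in> points (inverse_limit_uspace I le_idx X f) \<rightarrow> points (inverse_limit_uspace I le_idx X f)"
      using actL_closed[OF g] by (simp add: L_def)
    fix \<alpha> assume \<alpha>: "\<alpha> \<in> I"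
    have "ucont (X \<alpha>) (X \<alpha>) (act \<alpha> (g \<alpha>))"
      using ua[OF \<alpha>] g \<alpha> by (simp add: uniform_action_def uhomeo_def GL_threads threads_iff)
    then have "ucont L (X \<alpha>) (\<lambda>u. act \<alpha> (g \<alpha>) (u \<alpha>))"
      unfolding L_def by (rule ucont_compose[OF ucont_limit_projection[OF S \<alpha>]])
    then show "ucont (inverse_limit_uspace I le_idx X f) (X \<alpha>) (\<lambda>u. actL g u \<alpha>)"
      unfolding L_def[symmetric] by (rule ucont_cong[OF U, rotated]) (simp add: actL_coord \<alpha>)
  qed
qed

text \<open>
  Preimages, under one projection, of invariant entourages form a base of the limit
  uniformity, and they are invariant because the action is coordinatewise.
\<close>

lemma isomorphic_action_limit:
  assumes iso: "\<And>\<alpha>. \<alpha> \<in> I \<Longrightarrow> isomorphic_action (G \<alpha>) (X \<alpha>) (act \<alpha>)"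
  shows "isomorphic_action GL L actL"
  unfolding isomorphic_action_def
proof (intro conjI exI ballI)
  let ?B = "{W. entourage L W \<and> (\<forall>g\<in>carrier GL. map_prod (actL g) (actL g) ` W = W)}"
  show "uniform_action GL L actL" by (rule uniform_action_limit)
  show "map_prod (actL g) (actL g) ` W = W" if "W \<in> ?B" "g \<in> carrier GL" for W g
    using that by blast
  show "uniformity_base L ?B"
    unfolding uniformity_base_def
  proof (intro conjI allI impI ballI)
    show "entourage L W" if "W \<in> ?B" for W using that by blast
    fix D assume "entourage L D"
    then have "eventually (\<lambda>p. p \<in> D) (unif L)" by (simp add: entourage_def)
    then obtain \<alpha> Q where \<alpha>: "\<alpha> \<in> I" and Q: "eventually Q (unif (X \<alpha>))"
      "\<And>u v. u \<in> points L \<Longrightarrow> v \<in> points L \<Longrightarrow> Q (u \<alpha>, v \<alpha>) \<Longrightarrow> (u, v) \<in> D"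
      unfolding L_def eventually_inverse_limit[OF S] by blast
    have "uniform_space_on (X \<alpha>)" using S \<alpha> by (simp add: uspace_inverse_system_def)
    then obtain E where E: "entourage (X \<alpha>) E" "\<And>p. p \<in> E \<Longrightarrow> Q p"
      using Q(1) by (rule entourage_within) blast
    obtain B where B: "uniformity_base (X \<alpha>) B"
      "\<forall>E\<in>B. \<forall>g\<in>carrier (G \<alpha>). map_prod (act \<alpha> g) (act \<alpha> g) ` E = E"
      using iso[OF \<alpha>] unfolding isomorphic_action_def by blast
    obtain E' where "E' \<in> B" and E'_sub: "E' \<subseteq> E"
      using B(1) E(1) unfolding uniformity_base_def by blast
    then have E': "entourage (X \<alpha>) E'"
      "\<And>g. g \<in> carrier (G \<alpha>) \<Longrightarrow> map_prod (act \<alpha> g) (act \<alpha> g) ` E' = E'"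
      using B unfolding uniformity_base_def by blast+
    define W where "W = {(u, v) \<in> points L \<times> points L. (u \<alpha>, v \<alpha>) \<in> E'}"
    have "eventually (\<lambda>p. p \<in> W) (unif L)"
      unfolding L_def eventually_inverse_limit[OF S]
      using \<alpha> E'(1) by (intro bexI[of _ \<alpha>] exI[of _ "\<lambda>p. p \<in> E'"]) (auto simp: W_def L_def entourage_def)
    then have "entourage L W"
      using E'(1) by (auto simp: entourage_def W_def sym_def)
    moreover have "map_prod (actL g) (actL g) ` W = W" if "g \<in> carrier GL" for g
    proof (rule invariantI[OF group_action_limit _ _ that])
      show "W \<subseteq> points L \<times> points L" by (auto simp: W_def)
      fix g u v assume g: "g \<in> carrier GL" and uv: "(u, v) \<in> W"
      then have "g \<alpha> \<in> carrier (G \<alpha>)" using \<alpha> by (simp add: GL_threads threads_iff)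
      then have "map_prod (act \<alpha> (g \<alpha>)) (act \<alpha> (g \<alpha>)) (u \<alpha>, v \<alpha>) \<in> E'"
        using E'(2) uv unfolding W_def by blast
      then show "(actL g u, actL g v) \<in> W"
        using uv actL_closed[OF g] \<alpha> by (simp add: W_def actL_coord)
    qed
    moreover have "W \<subseteq> D" using E(2) E'_sub Q(2) by (auto simp: W_def)
    ultimately show "\<exists>W\<in>?B. W \<subseteq> D" by blast
  qed
qed

text \<open>
  At each index some group element moves \<open>u \<alpha>\<close> to \<open>v \<alpha>\<close>. Freeness makes it unique, and
  by equivariance the bonding homomorphisms send such an element to another one with the
  same property; hence the chosen elements form a thread.
\<close>

lemma same_orbit_limit:
  assumes free: "\<And>\<alpha> g x. \<alpha> \<in> I \<Longrightarrow> g \<in> carrier (G \<alpha>) \<Longrightarrow> x \<in> points (X \<alpha>) \<Longrightarrow>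
      act \<alpha> g x = x \<Longrightarrow> g = \<one>\<^bsub>G \<alpha>\<^esub>"
    and u: "u \<in> points L" and v: "v \<in> points L"
    and orb: "\<And>\<alpha>. \<alpha> \<in> I \<Longrightarrow> \<exists>g\<in>carrier (G \<alpha>). act \<alpha> g (u \<alpha>) = v \<alpha>"
  shows "\<exists>g\<in>carrier GL. actL g u = v"
proof -
  have "\<exists>g. \<forall>\<alpha>\<in>I. g \<alpha> \<in> carrier (G \<alpha>) \<and> act \<alpha> (g \<alpha>) (u \<alpha>) = v \<alpha>"
    using orb by (intro bchoice ballI) blast
  then obtain g where g: "\<And>\<alpha>. \<alpha> \<in> I \<Longrightarrow> g \<alpha> \<in> carrier (G \<alpha>)"
    "\<And>\<alpha>. \<alpha> \<in> I \<Longrightarrow> act \<alpha> (g \<alpha>) (u \<alpha>) = v \<alpha>" by blast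
  have uu: "\<And>\<alpha>. \<alpha> \<in> I \<Longrightarrow> u \<alpha> \<in> points (X \<alpha>)"
    "\<And>\<alpha> \<beta>. \<alpha> \<in> I \<Longrightarrow> \<beta> \<in> I \<Longrightarrow> le_idx \<alpha> \<beta> \<Longrightarrow> f \<alpha> \<beta> (u \<beta>) = u \<alpha>"
    using u by (auto simp: L_threads threads_iff)
  have vv: "v \<in> extensional I"
    "\<And>\<alpha> \<beta>. \<alpha> \<in> I \<Longrightarrow> \<beta> \<in> I \<Longrightarrow> le_idx \<alpha> \<beta> \<Longrightarrow> f \<alpha> \<beta> (v \<beta>) = v \<alpha>"
    using v by (auto simp: L_threads threads_iff)
  have compat: "h \<alpha> \<beta> (g \<beta>) = g \<alpha>" if ab: "\<alpha> \<in> I" "\<beta> \<in> I" "le_idx \<alpha> \<beta>" for \<alpha> \<beta>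
  proof -
    interpret A: group_action "G \<alpha>" "points (X \<alpha>)" "act \<alpha>" using ga ab by blast
    interpret grp: group "G \<alpha>" using group_action_is_group ga ab by blast
    have hg: "h \<alpha> \<beta> (g \<beta>) \<in> carrier (G \<alpha>)"
      using SG ab g(1)[OF ab(2)] unfolding group_inverse_system_def hom_def by blast
    have "act \<alpha> (h \<alpha> \<beta> (g \<beta>)) (u \<alpha>) = act \<alpha> (g \<alpha>) (u \<alpha>)"
      using equi ab g(1)[OF ab(2)] uu(1)[OF ab(2)] g(2)[OF ab(1)] g(2)[OF ab(2)] uu(2)[OF ab] vv(2)[OF ab]
      unfolding equivariant_bonds_def by fastforce
    \<comment> \<open>Both \<open>g \<alpha>\<close> and the image of \<open>g \<beta>\<close> move \<open>u \<alpha>\<close> to \<open>v \<alpha>\<close>, so their quotient fixes \<open>u \<alpha>\<close>.\<close>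
    then have "act \<alpha> (inv\<^bsub>G \<alpha>\<^esub> (g \<alpha>) \<otimes>\<^bsub>G \<alpha>\<^esub> h \<alpha> \<beta> (g \<beta>)) (u \<alpha>) = u \<alpha>"
      using A.composition_rule[OF uu(1)] A.orbit_sym_aux[OF g(1) uu(1)] ab g hg by simp
    then have "inv\<^bsub>G \<alpha>\<^esub> (g \<alpha>) \<otimes>\<^bsub>G \<alpha>\<^esub> h \<alpha> \<beta> (g \<beta>) = \<one>\<^bsub>G \<alpha>\<^esub>"
      using free ab(1) g(1) hg uu(1) by blast
    then have "inv\<^bsub>G \<alpha>\<^esub> (h \<alpha> \<beta> (g \<beta>)) = inv\<^bsub>G \<alpha>\<^esub> (g \<alpha>)"
      using g(1)[OF ab(1)] hg by (intro grp.inv_equality) simp_all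
    from arg_cong[OF this, of "m_inv (G \<alpha>)"] show ?thesis
      unfolding grp.inv_inv[OF hg] grp.inv_inv[OF g(1)[OF ab(1)]] .
  qed
  have "restrict g I \<in> carrier GL"
    using g(1) compat by (auto simp: GL_threads threads_iff)
  moreover have "actL (restrict g I) u = v"
  proof (rule extensionalityI[where A = I])
    show "actL (restrict g I) u \<in> extensional I"
      using u by (simp add: actL_def L_def limit_act_def)
  qed (use vv(1) g(2) u in \<open>auto simp: actL_coord\<close>)
  ultimately show ?thesis by blast
qed

end

definition cofinal_in :: "('i \<Rightarrow> 'i \<Rightarrow> bool) \<Rightarrow> 'i set \<Rightarrow> 'i set \<Rightarrow> bool" where
  "cofinal_in le_idx I J \<longleftrightarrow> J \<subseteq> I \<and> directed_set J le_idx \<and> (\<forall>\<alpha>\<in>I. \<exists>\<beta>\<in>J. le_idx \<alpha> \<beta>)"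

text \<open>
  A thread over a cofinal subset \<open>J\<close> extends to all of \<open>I\<close>: its value at \<open>\<alpha>\<close> is the image of
  its value at any index of \<open>J\<close> beyond \<open>\<alpha>\<close>, and by directedness of \<open>J\<close> the choice of that
  index does not matter. The lemma serves both spaces and groups.
\<close>

lemma bij_betw_threads_cofinal:
  assumes dir: "directed_set I le_idx" and func: "functorial I le_idx S f"
    and maps: "\<And>\<alpha> \<beta> x. \<alpha> \<in> I \<Longrightarrow> \<beta> \<in> I \<Longrightarrow> le_idx \<alpha> \<beta> \<Longrightarrow> x \<in> S \<beta> \<Longrightarrow> f \<alpha> \<beta> x \<in> S \<alpha>"
    and J: "cofinal_in le_idx I J"
  shows "bij_betw (\<lambda>u. restrict u J) (threads I le_idx S f) (threads J le_idx S f)"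
proof -
  have JI: "\<And>\<alpha>. \<alpha> \<in> J \<Longrightarrow> \<alpha> \<in> I" and cof: "\<And>\<alpha>. \<alpha> \<in> I \<Longrightarrow> \<exists>\<beta>\<in>J. le_idx \<alpha> \<beta>"
    and dJ: "\<And>\<alpha> \<beta>. \<alpha> \<in> J \<Longrightarrow> \<beta> \<in> J \<Longrightarrow> \<exists>\<gamma>\<in>J. le_idx \<alpha> \<gamma> \<and> le_idx \<beta> \<gamma>"
    using J unfolding cofinal_in_def directed_set_def by blast+
  have tr: "le_idx \<alpha> \<gamma>" if "\<alpha> \<in> I" "\<beta> \<in> I" "\<gamma> \<in> I" "le_idx \<alpha> \<beta>" "le_idx \<beta> \<gamma>" for \<alpha> \<beta> \<gamma>
    using dir that unfolding directed_set_def by blast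
  have ff: "f \<alpha> \<beta> (f \<beta> \<gamma> x) = f \<alpha> \<gamma> x"
    if "\<alpha> \<in> I" "\<beta> \<in> I" "\<gamma> \<in> I" "le_idx \<alpha> \<beta>" "le_idx \<beta> \<gamma>" "x \<in> S \<gamma>" for \<alpha> \<beta> \<gamma> x
    using func that unfolding functorial_def by blast
  define c where "c \<alpha> = (SOME \<beta>. \<beta> \<in> J \<and> le_idx \<alpha> \<beta>)" for \<alpha>
  have c: "c \<alpha> \<in> J" "le_idx \<alpha> (c \<alpha>)" if "\<alpha> \<in> I" for \<alpha>
    using someI_ex[of "\<lambda>\<beta>. \<beta> \<in> J \<and> le_idx \<alpha> \<beta>"] cof[OF that] by (auto simp: c_def)
  define e where "e v = (\<lambda>\<alpha>\<in>I. f \<alpha> (c \<alpha>) (v (c \<alpha>)))" for v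
  have indep: "f \<alpha> \<beta> (v \<beta>) = e v \<alpha>" if v: "v \<in> threads J le_idx S f" and a: "\<alpha> \<in> I" "\<beta> \<in> J" "le_idx \<alpha> \<beta>" for v \<alpha> \<beta>
  proof -
    obtain \<gamma> where \<gamma>: "\<gamma> \<in> J" "le_idx \<beta> \<gamma>" "le_idx (c \<alpha>) \<gamma>" using dJ[of \<beta> "c \<alpha>"] a c by blast
    have "v \<gamma> \<in> S \<gamma>" "f \<beta> \<gamma> (v \<gamma>) = v \<beta>" "f (c \<alpha>) \<gamma> (v \<gamma>) = v (c \<alpha>)"
      using v \<gamma> a c by (auto simp: threads_iff)
    then show ?thesis
      using ff[of \<alpha> \<beta> \<gamma> "v \<gamma>"] ff[of \<alpha> "c \<alpha>" \<gamma> "v \<gamma>"] a c \<gamma> JI by (simp add: e_def)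
  qed
  show ?thesis
  proof (rule bij_betwI[where g = e])
    show "(\<lambda>u. restrict u J) \<in> threads I le_idx S f \<rightarrow> threads J le_idx S f"
      using JI by (auto simp: threads_iff)
    show "e \<in> threads J le_idx S f \<rightarrow> threads I le_idx S f"
    proof
      fix v assume v: "v \<in> threads J le_idx S f"
      have vS: "v \<alpha> \<in> S \<alpha>" if "\<alpha> \<in> J" for \<alpha> using v that by (simp add: threads_iff)
      have "f \<alpha> \<beta> (e v \<beta>) = e v \<alpha>" if ab: "\<alpha> \<in> I" "\<beta> \<in> I" "le_idx \<alpha> \<beta>" for \<alpha> \<beta>
      proof -
        have "f \<alpha> \<beta> (e v \<beta>) = f \<alpha> (c \<beta>) (v (c \<beta>))"
          using ff[of \<alpha> \<beta> "c \<beta>"] ab c[of \<beta>] JI vS by (simp add: e_def)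
        also have "\<dots> = e v \<alpha>"
          using indep[OF v ab(1)] c[of \<beta>] tr[of \<alpha> \<beta> "c \<beta>"] ab JI by blast
        finally show ?thesis .
      qed
      moreover have "e v \<alpha> \<in> S \<alpha>" if "\<alpha> \<in> I" for \<alpha>
        using maps[of \<alpha> "c \<alpha>"] that c[OF that] JI vS by (simp add: e_def)
      ultimately show "e v \<in> threads I le_idx S f" by (auto simp: threads_iff e_def)
    qed
    show "e (restrict u J) = u" if u: "u \<in> threads I le_idx S f" for u
      using u c JI by (intro extensionalityI[where A = I]) (auto simp: e_def threads_iff)
    show "restrict (e v) J = v" if v: "v \<in> threads J le_idx S f" for v
    proof (rule extensionalityI[where A = J])
      fix \<alpha> assume \<alpha>: "\<alpha> \<in> J"
      have "le_idx \<alpha> \<alpha>" using dir JI[OF \<alpha>] by (simp add: directed_set_def)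
      then show "restrict (e v) J \<alpha> = v \<alpha>"
        using indep[OF v JI[OF \<alpha>] \<alpha>] v \<alpha> by (simp add: threads_iff)
    qed (use v in \<open>auto simp: threads_iff\<close>)
  qed
qed

lemma uhomeo_limit_cofinal:
  assumes S: "uspace_inverse_system I le_idx X f" and SJ: "uspace_inverse_system J le_idx X f"
    and J: "cofinal_in le_idx I J"
  shows "uhomeo (inverse_limit_uspace I le_idx X f) (inverse_limit_uspace J le_idx X f) (\<lambda>u. restrict u J)"
    (is "uhomeo ?L ?M ?r")
  unfolding uhomeo_def
proof (intro conjI)
  have JI: "J \<subseteq> I" using J by (simp add: cofinal_in_def)
  show bij: "bij_betw ?r (points ?L) (points ?M)"
    unfolding points_inverse_limit
    by (rule bij_betw_threads_cofinal[OF _ _ _ J])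
      (use S in \<open>auto simp: uspace_inverse_system_def ucont_def\<close>)
  show "ucont ?L ?M ?r"
  proof (rule ucont_into_limit[OF SJ uniform_space_on_inverse_limit[OF S]])
    show "?r \<in> points ?L \<rightarrow> points ?M" using bij by (auto simp: bij_betw_def)
    show "ucont ?L (X \<alpha>) (\<lambda>u. restrict u J \<alpha>)" if "\<alpha> \<in> J" for \<alpha>
      using ucont_limit_projection[OF S, of \<alpha>] that JI by auto
  qed
  let ?i = "inv_into (points ?L) ?r"
  show "ucont ?M ?L ?i"
  proof (rule ucont_into_limit[OF S uniform_space_on_inverse_limit[OF SJ]])
    show i: "?i \<in> points ?M \<rightarrow> points ?L"
      using bij_betw_inv_into[OF bij] by (auto simp: bij_betw_def)
    fix \<alpha> assume \<alpha>: "\<alpha> \<in> I"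
    then obtain \<beta> where \<beta>: "\<beta> \<in> J" "le_idx \<alpha> \<beta>" using J by (auto simp: cofinal_in_def)
    have "ucont (X \<beta>) (X \<alpha>) (f \<alpha> \<beta>)"
      using S \<alpha> \<beta> JI by (auto simp: uspace_inverse_system_def)
    then have "ucont ?M (X \<alpha>) (\<lambda>v. f \<alpha> \<beta> (v \<beta>))"
      by (rule ucont_compose[OF ucont_limit_projection[OF SJ \<beta>(1)]])
    moreover have "f \<alpha> \<beta> (v \<beta>) = ?i v \<alpha>" if v: "v \<in> points ?M" for v
    proof -
      have "?i v \<in> points ?L" "?r (?i v) = v"
        using i v bij_betw_inv_into_right[OF bij v] by auto
      then have "f \<alpha> \<beta> (?i v \<beta>) = ?i v \<alpha>" "?r (?i v) \<beta> = v \<beta>"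
        using \<alpha> \<beta> JI by (auto simp: points_inverse_limit threads_iff)
      then have "f \<alpha> \<beta> (?i v \<beta>) = ?i v \<alpha>" "?i v \<beta> = v \<beta>"
        using \<beta> by simp_all
      then show ?thesis by simp
    qed
    ultimately show "ucont ?M (X \<alpha>) (\<lambda>v. ?i v \<alpha>)"
      by (rule ucont_cong[OF uniform_space_on_inverse_limit[OF SJ], rotated])
  qed
qed

lemma iso_limit_cofinal:
  assumes S: "group_inverse_system I le_idx G h" and J: "cofinal_in le_idx I J"
  shows "(\<lambda>u. restrict u J) \<in> iso (inverse_limit_group I le_idx G h) (inverse_limit_group J le_idx G h)"
proof -
  have "bij_betw (\<lambda>u. restrict u J) (threads I le_idx (\<lambda>\<alpha>. carrier (G \<alpha>)) h)
          (threads J le_idx (\<lambda>\<alpha>. carrier (G \<alpha>)) h)"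
    by (rule bij_betw_threads_cofinal[OF _ _ _ J])
      (use S in \<open>auto simp: group_inverse_system_def hom_def\<close>)
  moreover have "restrict (\<lambda>\<alpha>\<in>I. x \<alpha> \<otimes>\<^bsub>G \<alpha>\<^esub> y \<alpha>) J =
      (\<lambda>\<alpha>\<in>J. restrict x J \<alpha> \<otimes>\<^bsub>G \<alpha>\<^esub> restrict y J \<alpha>)" for x y
    using J by (auto simp: cofinal_in_def restrict_def fun_eq_iff)
  ultimately show ?thesis
    by (auto simp: iso_def hom_def carrier_inverse_limit mult_inverse_limit bij_betw_def)
qed

text \<open>
  The limit is taken over all of \<open>I\<close>, but the system exhibiting the action as prodiscrete
  must have surjective projections. It is therefore the system restricted to a cofinal
  subset \<open>J\<close> on which the projections are onto; restricting threads to \<open>J\<close> identifies the limits.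
\<close>

lemma prodiscrete_action_limit:
  fixes I :: "'i set" and X :: "'i \<Rightarrow> 'x uspace" and G :: "'i \<Rightarrow> 'g monoid"
  assumes S: "uspace_inverse_system I le_idx X f" and SG: "group_inverse_system I le_idx G h"
    and equi: "equivariant_bonds I le_idx X f G h act"
    and dis: "\<And>\<alpha>. \<alpha> \<in> I \<Longrightarrow> discrete_action (G \<alpha>) (X \<alpha>) (act \<alpha>)"
    and J: "cofinal_in le_idx I J"
    and surj: "\<And>\<alpha>. \<alpha> \<in> J \<Longrightarrow> (\<lambda>u. u \<alpha>) ` points (inverse_limit_uspace I le_idx X f) = points (X \<alpha>)"
  shows "prodiscrete_action TYPE('i) TYPE('x) TYPE('g) (inverse_limit_group I le_idx G h)
           (inverse_limit_uspace I le_idx X f) (limit_act I le_idx X f act)"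
  unfolding prodiscrete_action_def
proof (intro conjI exI)
  have JI: "J \<subseteq> I" and dJ: "directed_set J le_idx" using J by (simp_all add: cofinal_in_def)
  show "uniform_action (inverse_limit_group I le_idx G h) (inverse_limit_uspace I le_idx X f)
          (limit_act I le_idx X f act)"
    by (rule uniform_action_limit[OF S SG equi]) (use dis in \<open>auto simp: discrete_action_def\<close>)
  show SJ: "uspace_inverse_system J le_idx X f"
    using S dJ unfolding uspace_inverse_system_def functorial_def
    by (intro conjI ballI impI) (blast intro: subsetD[OF JI])+
  show "group_inverse_system J le_idx G h"
    using SG dJ unfolding group_inverse_system_def functorial_def
    by (intro conjI ballI impI) (blast intro: subsetD[OF JI])+
  show "\<forall>\<alpha>\<in>J. discrete_action (G \<alpha>) (X \<alpha>) (act \<alpha>)" using dis JI by blast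
  show "equivariant_bonds J le_idx X f G h act"
    using equi JI by (auto simp: equivariant_bonds_def)
  show "uhomeo (inverse_limit_uspace I le_idx X f) (inverse_limit_uspace J le_idx X f) (\<lambda>u. restrict u J)"
    by (rule uhomeo_limit_cofinal[OF S SJ J])
  show "\<forall>\<alpha>\<in>J. (\<lambda>u. restrict u J \<alpha>) ` points (inverse_limit_uspace I le_idx X f) = points (X \<alpha>)"
    using surj by simp
  show "(\<lambda>u. restrict u J) \<in> iso (inverse_limit_group I le_idx G h) (inverse_limit_group J le_idx G h)"
    by (rule iso_limit_cofinal[OF SG J])
  show "\<forall>g\<in>carrier (inverse_limit_group I le_idx G h). \<forall>u\<in>points (inverse_limit_uspace I le_idx X f).
      \<forall>\<alpha>\<in>J. restrict (limit_act I le_idx X f act g u) J \<alpha> =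
        act \<alpha> (restrict g J \<alpha>) (restrict u J \<alpha>)"
    using JI by (auto simp: limit_act_coord)
qed


section \<open>Chains and one-point extensions\<close>

lemma entourage_refl: "E \<in> entourages \<Longrightarrow> (x, x) \<in> E"
  using uniformity_refl[of "\<lambda>p. p \<in> E"] by (simp add: entourage_def class_uspace_def)

lemma entourage_sym: "E \<in> entourages \<Longrightarrow> (x, y) \<in> E \<Longrightarrow> (y, x) \<in> E"
  by (auto simp: entourage_def sym_def)

lemma UNIV_entourage: "UNIV \<in> entourages"
  by (simp add: entourage_def class_uspace_def sym_def)

lemma directed_entourages: "directed_set entourages (\<lambda>E F. F \<subseteq> E)"
  unfolding directed_set_def using UNIV_entourage entourage_Int[of class_uspace]
  by (auto 4 4 intro: exI[of _ "_ \<inter> _"])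

lemma entourage_halving:
  assumes "D \<in> entourages"
  obtains D' where "D' \<in> entourages" "D' \<subseteq> D" "D' O D' \<subseteq> D"
proof -
  have "eventually (\<lambda>p. p \<in> D) (unif class_uspace)"
    using assms by (simp add: entourage_def)
  then obtain Q where Q: "eventually Q (unif class_uspace)"
    "\<forall>x y z. Q (x, y) \<longrightarrow> Q (y, z) \<longrightarrow> (x, z) \<in> D"
    using uniform_space_on_transD[OF uniform_space_on_class_uspace] by blast
  obtain D' where D': "entourage class_uspace D'" "\<And>p. p \<in> D' \<Longrightarrow> Q p"
    using entourage_within[OF uniform_space_on_class_uspace Q(1)] by blast
  show thesis
  proof (rule that[of "D' \<inter> D"])
    show "D' \<inter> D \<in> entourages" using D'(1) assms by (simp add: entourage_Int)
    show "(D' \<inter> D) O (D' \<inter> D) \<subseteq> D" using D'(2) Q(2) by blast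
  qed simp
qed

lemma chain_append_iff:
  "xs \<noteq> [] \<Longrightarrow> ys \<noteq> [] \<Longrightarrow> chain E (xs @ ys) \<longleftrightarrow> chain E xs \<and> chain E ys \<and> (last xs, hd ys) \<in> E"
  by (auto simp: chain_def successively_append_iff)

lemma chain_snoc: "xs \<noteq> [] \<Longrightarrow> chain E (xs @ [y]) \<longleftrightarrow> chain E xs \<and> (last xs, y) \<in> E"
  by (auto simp: chain_def successively_append_iff)

lemma chain_not_Nil: "chain E xs \<Longrightarrow> xs \<noteq> []"
  by (simp add: chain_def)

lemma chain_rev: "E \<in> entourages \<Longrightarrow> chain E xs \<Longrightarrow> chain E (rev xs)"
  unfolding chain_def
  by (auto elim: successively_mono intro: entourage_sym)

lemma homotopic_adds_point: "adds_point E xs ys \<Longrightarrow> homotopic E xs ys"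
  unfolding homotopic_def by (rule r_into_rtranclp) simp

lemma homotopic_insert:
  assumes "chain E (us @ vs)" "chain E (us @ z # vs)" "us \<noteq> []" "vs \<noteq> []"
  shows "homotopic E (us @ vs) (us @ z # vs)"
  by (rule homotopic_adds_point) (use assms in \<open>auto simp: adds_point_def\<close>)

text \<open>
  Repeating the last point means inserting a point after all others.
\<close>

lemma homotopic_repeat_last:
  assumes "E \<in> entourages" "chain E xs"
  shows "homotopic E xs (xs @ [last xs])"
proof (rule homotopic_adds_point)
  have "\<exists>us z vs. xs = us @ vs \<and> xs @ [last xs] = us @ [z] @ vs"
    by (intro exI[of _ xs] exI[of _ "last xs"] exI[of _ "[]"]) simp
  then show "adds_point E xs (xs @ [last xs])"
    using assms(2) chain_not_Nil[OF assms(2)] entourage_refl[OF assms(1)]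
    by (simp add: adds_point_def chain_snoc)
qed

text \<open>
  The basic triangle move: the intermediate point \<open>y\<close> can be dropped as soon as the
  direct step is allowed.
\<close>

lemma hclass_skip:
  assumes "chain E xs" "(last xs, y) \<in> E" "(y, z) \<in> E" "(last xs, z) \<in> E"
  shows "hclass E (xs @ [y, z]) = hclass E (xs @ [z])"
proof -
  have "chain E [z]" "chain E [y, z]" using assms(3) by (simp_all add: chain_def)
  then have "homotopic E (xs @ [z]) (xs @ y # [z])"
    using assms chain_not_Nil[OF assms(1)]
    by (intro homotopic_insert) (simp_all add: chain_snoc chain_append_iff)
  from homotopic_sym[OF this] show ?thesis by (simp add: hclass_eq_iff)
qed

lemma hclass_endpoints: "hclass E xs = hclass E ys \<Longrightarrow> hd xs = hd ys \<and> last xs = last ys"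
  by (simp add: hclass_eq_iff homotopic_endpoints)

lemma hclass_snoc_cong:
  assumes "hclass E xs = hclass E ys" "chain E xs" "(last xs, z) \<in> E"
  shows "hclass E (xs @ [z]) = hclass E (ys @ [z])"
proof -
  have "chain E [last xs, z]" using assms(3) by (simp add: chain_def)
  then have "homotopic E (xs @ tl [last xs, z]) (ys @ tl [last xs, z])"
    using assms by (intro homotopic_concat_left) (simp_all add: hclass_eq_iff)
  then show ?thesis by (simp add: hclass_eq_iff)
qed

text \<open>
  A chain followed by its reverse contracts to its starting point by retracting the turning
  point: in \<open>..., y, z, y, ...\<close> first \<open>z\<close> is removed, which needs \<open>(y, y)\<close> to be an allowed step,
  and then the repeated \<open>y\<close>.
\<close>

lemma homotopic_inverse:
  assumes E: "E \<in> entourages" and "chain E xs"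
  shows "homotopic E (xs @ tl (rev xs)) [hd xs]"
  using assms(2)
proof (induction xs rule: rev_induct)
  case Nil
  then show ?case by (simp add: chain_def)
next
  case (snoc z ys)
  show ?case
  proof (cases "ys = []")
    case True
    then show ?thesis by (simp add: homotopic_refl)
  next
    case False
    have ys: "chain E ys" "(last ys, z) \<in> E" using snoc.prems False by (auto simp: chain_snoc)
    have rys: "chain E (rev ys)" "hd (rev ys) = last ys" "rev ys \<noteq> []"
      using chain_rev[OF E ys(1)] False by (simp_all add: hd_rev)
    have "homotopic E (ys @ rev ys) (ys @ z # rev ys)"
    proof (rule homotopic_insert)
      show "chain E (ys @ rev ys)"
        using ys rys False entourage_refl[OF E] by (simp add: chain_append_iff)
      have "chain E (z # rev ys)"
        using chain_append_iff[of "[z]" "rev ys"] rys entourage_sym[OF E ys(2)] by (simp add: chain_def)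
      then show "chain E (ys @ z # rev ys)"
        using ys False by (simp add: chain_append_iff)
    qed (use False in auto)
    then have "homotopic E (ys @ z # rev ys) (ys @ rev ys)" by (rule homotopic_sym)
    moreover have "homotopic E (ys @ rev ys) (ys @ tl (rev ys))"
    proof -
      have "homotopic E (ys @ tl (rev ys)) ((ys @ [last ys]) @ tl (rev ys))"
        by (rule homotopic_concat_left[OF homotopic_repeat_last[OF E ys(1)] rys(1)]) (simp add: rys)
      moreover have "(ys @ [last ys]) @ tl (rev ys) = ys @ rev ys"
        using list.collapse[OF rys(3)] rys(2) by simp
      ultimately show ?thesis by (metis homotopic_sym)
    qed
    ultimately have "homotopic E (ys @ z # rev ys) [hd ys]"
      using snoc.IH[OF ys(1)] by (meson homotopic_trans)
    then show ?thesis using False by simp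
  qed
qed


section \<open>The uniformity of the chain spaces\<close>

lemma points_chain_space:
  "c \<in> points (chain_space b E) \<longleftrightarrow> (\<exists>xs. c = hclass E xs \<and> chain E xs \<and> hd xs = b)"
  by (auto simp: chain_space_def)

text \<open>
  This lemma and its converse \<open>star_relE\<close> describe a pair in the basic relation asymmetrically:
  the second class extends the first one by a single step in \<open>D\<close>. All computations with the
  uniformity of the chain spaces use this description.
\<close>

lemma star_relI:
  assumes "E \<in> entourages" "D \<subseteq> E" "chain E xs" "hd xs = b" "(last xs, z) \<in> D"
  shows "(hclass E xs, hclass E (xs @ [z])) \<in> star_rel b E D"
proof -
  have ne: "xs \<noteq> []" using assms(3) by (rule chain_not_Nil)
  have "hclass E xs = hclass E (xs @ [last xs])"
    using homotopic_repeat_last[OF assms(1,3)] by (simp add: hclass_eq_iff)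
  moreover have "chain E (xs @ [last xs])" "chain E (xs @ [z])"
    using assms entourage_refl[OF assms(1)] ne by (auto simp: chain_snoc)
  ultimately show ?thesis
    unfolding star_rel_def using assms(4,5) ne by blast
qed

lemma star_relE:
  assumes "(c, d) \<in> star_rel b E D" "D \<subseteq> E"
  obtains xs z where "c = hclass E xs" "d = hclass E (xs @ [z])" "chain E xs" "hd xs = b" "(last xs, z) \<in> D"
proof -
  obtain xs y z where p: "c = hclass E (xs @ [y])" "d = hclass E (xs @ [z])" "xs \<noteq> []" "hd xs = b"
    "chain E (xs @ [y])" "chain E (xs @ [z])" "(y, z) \<in> D"
    using assms(1) by (auto simp: star_rel_def)
  have "hclass E (xs @ [y, z]) = hclass E (xs @ [z])"
    using p(3,5-7) assms(2) by (intro hclass_skip) (auto simp: chain_snoc)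
  then show thesis
    using that[of "xs @ [y]" z] p by simp
qed

lemma star_rel_subset: "star_rel b E D \<subseteq> points (chain_space b E) \<times> points (chain_space b E)"
proof -
  have "hclass E (xs @ [y]) \<in> points (chain_space b E)"
    if "xs \<noteq> []" "hd xs = b" "chain E (xs @ [y])" for xs y
    unfolding points_chain_space using that by (intro exI[of _ "xs @ [y]"]) simp
  then show ?thesis by (auto simp: star_rel_def)
qed

lemma sym_star_rel: "sym D \<Longrightarrow> sym (star_rel b E D)"
  unfolding star_rel_def sym_def by blast

lemma star_rel_refl:
  assumes "E \<in> entourages" "D \<in> entourages" "D \<subseteq> E" "c \<in> points (chain_space b E)"
  shows "(c, c) \<in> star_rel b E D"
proof -
  obtain xs where xs: "c = hclass E xs" "chain E xs" "hd xs = b"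
    using assms(4) by (auto simp: points_chain_space)
  have "hclass E xs = hclass E (xs @ [last xs])"
    using homotopic_repeat_last[OF assms(1) xs(2)] by (simp add: hclass_eq_iff)
  then show ?thesis
    using star_relI[OF assms(1,3) xs(2,3) entourage_refl[OF assms(2)]] xs(1) by simp
qed

text \<open>
  Two successive extensions by \<open>D'\<close>-steps append points \<open>z\<close> and \<open>w\<close> to a chain; since the direct
  step to \<open>w\<close> lies in \<open>D\<close>, hence in \<open>E\<close>, the triangle move drops \<open>z\<close>.
\<close>

lemma star_rel_trans:
  assumes E: "E \<in> entourages" and D: "D \<subseteq> E" "D' \<subseteq> D" "D' O D' \<subseteq> D"
    and cd: "(c, d) \<in> star_rel b E D'" and de: "(d, e) \<in> star_rel b E D'"
  shows "(c, e) \<in> star_rel b E D"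
proof -
  have D'E: "D' \<subseteq> E" using D by blast
  obtain xs z where xs: "c = hclass E xs" "d = hclass E (xs @ [z])" "chain E xs" "hd xs = b"
    "(last xs, z) \<in> D'"
    using star_relE[OF cd D'E] by blast
  obtain ys w where ys: "d = hclass E ys" "e = hclass E (ys @ [w])" "chain E ys" "(last ys, w) \<in> D'"
    using star_relE[OF de D'E] by blast
  have eq: "hclass E ys = hclass E (xs @ [z])" using xs ys by simp
  then have "last ys = z" using hclass_endpoints[OF eq] by simp
  then have w: "(z, w) \<in> D'" "(last xs, w) \<in> D" using ys(4) xs(5) D(3) by blast+
  have "e = hclass E ((xs @ [z]) @ [w])"
    unfolding ys(2) by (rule hclass_snoc_cong[OF eq ys(3)]) (use ys(4) D'E in blast)
  also have "\<dots> = hclass E (xs @ [w])"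
    using hclass_skip[OF xs(3), of z w] xs(5) w D'E D(1) by auto
  finally show ?thesis
    using star_relI[OF E D(1) xs(3,4) w(2)] xs(1) by simp
qed

lemma uniform_space_on_chain_space:
  assumes E: "E \<in> entourages"
  shows "uniform_space_on (chain_space b E)"
  unfolding uniform_space_on_def eventually_chain_space[OF E]
proof (intro conjI allI impI ballI)
  show "unif (chain_space b E) \<le> principal (points (chain_space b E) \<times> points (chain_space b E))"
    unfolding le_principal eventually_chain_space[OF E] using E star_rel_subset by blast
  fix P assume "\<exists>D\<in>entourages. D \<subseteq> E \<and> (\<forall>p\<in>star_rel b E D. P p)"
  then obtain D where D: "D \<in> entourages" "D \<subseteq> E" and P: "\<And>p. p \<in> star_rel b E D \<Longrightarrow> P p"
    by blast
  show "P (c, c)" if "c \<in> points (chain_space b E)" for c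
    using P star_rel_refl[OF E D that] by blast
  have "sym (star_rel b E D)"
    using D(1) by (intro sym_star_rel) (simp add: entourage_def)
  then show "\<exists>D\<in>entourages. D \<subseteq> E \<and> (\<forall>p\<in>star_rel b E D. case p of (x, y) \<Rightarrow> P (y, x))"
    using D P by (intro bexI[of _ D]) (auto dest: symD)
  obtain D' where D': "D' \<in> entourages" "D' \<subseteq> D" "D' O D' \<subseteq> D"
    using entourage_halving[OF D(1)] by blast
  show "\<exists>Q. (\<exists>D\<in>entourages. D \<subseteq> E \<and> (\<forall>p\<in>star_rel b E D. Q p)) \<and>
          (\<forall>x y z. Q (x, y) \<longrightarrow> Q (y, z) \<longrightarrow> P (x, z))"
  proof (intro exI conjI allI impI)
    show "\<exists>D\<in>entourages. D \<subseteq> E \<and> (\<forall>p\<in>star_rel b E D. p \<in> star_rel b E D')"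
      using D' D(2) by blast
    show "P (x, z)" if "(x, y) \<in> star_rel b E D'" "(y, z) \<in> star_rel b E D'" for x y z
      using P star_rel_trans[OF E D(2) D'(2,3) that] by blast
  qed
qed

lemma entourage_star_rel:
  assumes "E \<in> entourages" "D \<in> entourages" "D \<subseteq> E"
  shows "entourage (chain_space b E) (star_rel b E D)"
  unfolding entourage_def
proof (intro conjI)
  show "star_rel b E D \<subseteq> points (chain_space b E) \<times> points (chain_space b E)"
    by (rule star_rel_subset)
  show "sym (star_rel b E D)" using assms(2) by (intro sym_star_rel) (simp add: entourage_def)
  show "eventually (\<lambda>p. p \<in> star_rel b E D) (unif (chain_space b E))"
    unfolding eventually_chain_space[OF assms(1)] using assms(2,3) by blast
qed

lemma uniformity_base_star_rel:
  assumes E: "E \<in> entourages"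
  shows "uniformity_base (chain_space b E) {star_rel b E D | D. D \<in> entourages \<and> D \<subseteq> E}"
  unfolding uniformity_base_def
proof (intro conjI ballI allI impI)
  show "entourage (chain_space b E) W" if "W \<in> {star_rel b E D | D. D \<in> entourages \<and> D \<subseteq> E}" for W
    using that entourage_star_rel[OF E] by auto
  fix W assume "entourage (chain_space b E) W"
  then have "\<exists>D\<in>entourages. D \<subseteq> E \<and> (\<forall>p\<in>star_rel b E D. p \<in> W)"
    using eventually_chain_space[OF E, of "\<lambda>p. p \<in> W"] by (simp add: entourage_def)
  then show "\<exists>V\<in>{star_rel b E D | D. D \<in> entourages \<and> D \<subseteq> E}. V \<subseteq> W" by blast
qed

lemma class_map_point:
  assumes "F \<subseteq> E" "c \<in> points (chain_space b F)"
  shows "class_map E F c \<in> points (chain_space b E)"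
proof -
  obtain xs where "c = hclass F xs" "chain F xs" "hd xs = b"
    using assms(2) by (auto simp: points_chain_space)
  then show ?thesis
    using chain_mono[OF _ assms(1)] by (auto simp: points_chain_space class_map_hclass[OF assms(1)])
qed

lemma star_rel_class_map:
  assumes "F \<subseteq> E" "(c, d) \<in> star_rel b F D"
  shows "(class_map E F c, class_map E F d) \<in> star_rel b E D"
proof -
  obtain xs y z where "c = hclass F (xs @ [y])" "d = hclass F (xs @ [z])" "xs \<noteq> []" "hd xs = b"
    "chain F (xs @ [y])" "chain F (xs @ [z])" "(y, z) \<in> D"
    using assms(2) by (auto simp: star_rel_def)
  then show ?thesis
    unfolding star_rel_def using chain_mono[OF _ assms(1)]
    by (simp add: class_map_hclass[OF assms(1)]) blast
qed

lemma ucont_class_map: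
  assumes "E \<in> entourages" "F \<in> entourages" "F \<subseteq> E"
  shows "ucont (chain_space b F) (chain_space b E) (class_map E F)"
  unfolding ucont_iff_eventually eventually_chain_space[OF assms(1)] eventually_chain_space[OF assms(2)]
proof (intro conjI allI impI)
  show "class_map E F \<in> points (chain_space b F) \<rightarrow> points (chain_space b E)"
    using class_map_point[OF assms(3)] by blast
  fix P assume "\<exists>D\<in>entourages. D \<subseteq> E \<and> (\<forall>p\<in>star_rel b E D. P p)"
  then obtain D where D: "D \<in> entourages" "\<And>p. p \<in> star_rel b E D \<Longrightarrow> P p" by blast
  have "P (class_map E F c, class_map E F d)" if "(c, d) \<in> star_rel b F (D \<inter> F)" for c d
    using D(2) star_rel_class_map[OF assms(3) that] star_rel_mono[of "D \<inter> F" D b E] by blast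
  moreover have "D \<inter> F \<in> entourages" using D(1) assms(2) by (simp add: entourage_Int)
  ultimately show "\<exists>D\<in>entourages. D \<subseteq> F \<and>
      (\<forall>p\<in>star_rel b F D. P (class_map E F (fst p), class_map E F (snd p)))"
    by (intro bexI[of _ "D \<inter> F"]) auto
qed

lemma uspace_inverse_system_chain_space:
  assumes "J \<subseteq> entourages" "directed_set J (\<lambda>E F. F \<subseteq> E)"
  shows "uspace_inverse_system J (\<lambda>E F. F \<subseteq> E) (chain_space b) class_map"
  unfolding uspace_inverse_system_def
proof (intro conjI ballI impI)
  show "functorial J (\<lambda>E F. F \<subseteq> E) (\<lambda>E. points (chain_space b E)) class_map"
    by (auto simp: functorial_def points_chain_space class_map_hclass)
  show "uniform_space_on (chain_space b E)" if "E \<in> J" for E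
    using that assms(1) uniform_space_on_chain_space by blast
  show "ucont (chain_space b F) (chain_space b E) (class_map E F)" if "E \<in> J" "F \<in> J" "F \<subseteq> E" for E F
    using that assms(1) ucont_class_map by blast
qed (fact assms(2))

lemma endpoint_class_map:
  assumes "F \<subseteq> E" "c \<in> points (chain_space b F)"
  shows "endpoint (class_map E F c) = endpoint c"
  using assms(2) by (auto simp: points_chain_space class_map_hclass[OF assms(1)] endpoint_hclass)


section \<open>The groups of loops and their actions\<close>

lemma carrier_delta:
  "c \<in> carrier (delta b E) \<longleftrightarrow> (\<exists>xs. c = hclass E xs \<and> chain E xs \<and> hd xs = b \<and> last xs = b)"
  by (auto simp: delta_def)

lemma mult_delta: "x \<otimes>\<^bsub>delta b E\<^esub> y = class_concat E x y"
  by (simp add: delta_def)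

lemma one_delta: "\<one>\<^bsub>delta b E\<^esub> = hclass E [b]"
  by (simp add: delta_def)

lemma append_tl_assoc: "ys \<noteq> [] \<Longrightarrow> (xs @ tl ys) @ tl zs = xs @ tl (ys @ tl zs)"
  by simp

text \<open>
  Inverses are given by reversed loops.
\<close>

lemma group_delta:
  assumes E: "E \<in> entourages"
  shows "group (delta b E)"
proof (rule groupI)
  have cc: "chain E (xs @ tl ys) \<and> hd (xs @ tl ys) = b \<and> last (xs @ tl ys) = b \<and>
      class_concat E (hclass E xs) (hclass E ys) = hclass E (xs @ tl ys)"
    if "chain E xs" "hd xs = b" "last xs = b" "chain E ys" "hd ys = b" "last ys = b" for xs ys
    using that chain_concat[of E xs ys] class_concat_hclass[of E xs ys] by simp
  show "x \<otimes>\<^bsub>delta b E\<^esub> y \<in> carrier (delta b E)"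
    if "x \<in> carrier (delta b E)" "y \<in> carrier (delta b E)" for x y
    using that cc unfolding carrier_delta mult_delta by metis
  show "\<one>\<^bsub>delta b E\<^esub> \<in> carrier (delta b E)"
    unfolding carrier_delta one_delta by (intro exI[of _ "[b]"]) (simp add: chain_def)
  show "x \<otimes>\<^bsub>delta b E\<^esub> y \<otimes>\<^bsub>delta b E\<^esub> z = x \<otimes>\<^bsub>delta b E\<^esub> (y \<otimes>\<^bsub>delta b E\<^esub> z)"
    if xyz: "x \<in> carrier (delta b E)" "y \<in> carrier (delta b E)" "z \<in> carrier (delta b E)" for x y z
  proof -
    obtain xs ys zs where
      x: "x = hclass E xs" "chain E xs" "hd xs = b" "last xs = b" and
      y: "y = hclass E ys" "chain E ys" "hd ys = b" "last ys = b" and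
      z: "z = hclass E zs" "chain E zs" "hd zs = b" "last zs = b"
      using xyz unfolding carrier_delta by blast
    note xy = cc[OF x(2-4) y(2-4)] and yz = cc[OF y(2-4) z(2-4)]
    have "class_concat E (hclass E (xs @ tl ys)) (hclass E zs) = hclass E ((xs @ tl ys) @ tl zs)"
      using cc[of "xs @ tl ys" zs] xy z by blast
    moreover have "class_concat E (hclass E xs) (hclass E (ys @ tl zs)) = hclass E (xs @ tl (ys @ tl zs))"
      using cc[of xs "ys @ tl zs"] yz x by blast
    ultimately show ?thesis
      using xy yz append_tl_assoc[OF chain_not_Nil[OF y(2)]] by (simp add: mult_delta x(1) y(1) z(1))
  qed
  fix x assume "x \<in> carrier (delta b E)"
  then obtain xs where x: "x = hclass E xs" "chain E xs" "hd xs = b" "last xs = b"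
    by (auto simp: carrier_delta)
  have ne: "xs \<noteq> []" using x(2) by (rule chain_not_Nil)
  have b: "chain E [b]" by (simp add: chain_def)
  have "[b] @ tl xs = xs" using x(3) ne by (cases xs) auto
  then show "\<one>\<^bsub>delta b E\<^esub> \<otimes>\<^bsub>delta b E\<^esub> x = x"
    using cc[OF b _ _ x(2-4)] x(1) by (simp add: mult_delta one_delta)
  have r: "chain E (rev xs)" "hd (rev xs) = b" "last (rev xs) = b"
    using chain_rev[OF E x(2)] x ne by (simp_all add: hd_rev last_rev)
  have "hclass E (rev xs @ tl xs) = hclass E [b]"
    using homotopic_inverse[OF E r(1)] r(2) by (simp add: hclass_eq_iff)
  then have "hclass E (rev xs) \<otimes>\<^bsub>delta b E\<^esub> x = \<one>\<^bsub>delta b E\<^esub>"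
    using cc[OF r x(2-4)] by (simp add: mult_delta one_delta x(1))
  moreover have "hclass E (rev xs) \<in> carrier (delta b E)"
    unfolding carrier_delta using r by blast
  ultimately show "\<exists>y\<in>carrier (delta b E). y \<otimes>\<^bsub>delta b E\<^esub> x = \<one>\<^bsub>delta b E\<^esub>" by blast
qed

lemma delta_act_hclass:
  assumes "chain E ls" "hd ls = b" "last ls = b" "chain E xs" "hd xs = b"
  shows "delta_act b E (hclass E ls) (hclass E xs) = hclass E (ls @ tl xs)"
    and "chain E (ls @ tl xs)" "hd (ls @ tl xs) = b" "last (ls @ tl xs) = last xs"
proof -
  show "chain E (ls @ tl xs)" "hd (ls @ tl xs) = b" "last (ls @ tl xs) = last xs"
    using chain_concat[of E ls xs] assms by auto
  have "hclass E xs \<in> points (chain_space b E)"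
    unfolding points_chain_space using assms by blast
  then show "delta_act b E (hclass E ls) (hclass E xs) = hclass E (ls @ tl xs)"
    using assms by (simp add: delta_act_def class_concat_hclass)
qed

lemma group_action_delta:
  assumes E: "E \<in> entourages"
  shows "group_action (delta b E) (points (chain_space b E)) (delta_act b E)"
proof (rule group_actionI)
  show "group (delta b E)" by (rule group_delta[OF E])
  show "delta_act b E g \<in> extensional (points (chain_space b E))" for g
    by (simp add: delta_act_def)
  show "delta_act b E g c \<in> points (chain_space b E)"
    if "g \<in> carrier (delta b E)" "c \<in> points (chain_space b E)" for g c
    using that delta_act_hclass unfolding carrier_delta points_chain_space by metis
  show "delta_act b E \<one>\<^bsub>delta b E\<^esub> c = c" if c: "c \<in> points (chain_space b E)" for c
  proof -
    obtain xs where xs: "c = hclass E xs" "chain E xs" "hd xs = b"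
      using c by (auto simp: points_chain_space)
    have "[b] @ tl xs = xs" using xs(3) chain_not_Nil[OF xs(2)] by (cases xs) auto
    then show ?thesis
      using delta_act_hclass(1)[of E "[b]" b xs] xs by (simp add: one_delta chain_def)
  qed
  show "delta_act b E (g \<otimes>\<^bsub>delta b E\<^esub> k) c = delta_act b E g (delta_act b E k c)"
    if gkc: "g \<in> carrier (delta b E)" "k \<in> carrier (delta b E)" "c \<in> points (chain_space b E)" for g k c
  proof -
    obtain gs ks xs where
      g: "g = hclass E gs" "chain E gs" "hd gs = b" "last gs = b" and
      k: "k = hclass E ks" "chain E ks" "hd ks = b" "last ks = b" and
      x: "c = hclass E xs" "chain E xs" "hd xs = b"
      using gkc unfolding carrier_delta points_chain_space by blast
    note kx = delta_act_hclass[OF k(2-4) x(2,3)]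
    have "g \<otimes>\<^bsub>delta b E\<^esub> k = hclass E (gs @ tl ks)"
      using class_concat_hclass[of E gs ks] g k by (simp add: mult_delta)
    moreover have "delta_act b E (hclass E (gs @ tl ks)) c = hclass E ((gs @ tl ks) @ tl xs)"
      using chain_concat[of E gs ks] g k x by (simp add: delta_act_hclass)
    moreover have "delta_act b E g (delta_act b E k c) = hclass E (gs @ tl (ks @ tl xs))"
      unfolding g(1) k(1) x(1) kx(1) by (rule delta_act_hclass(1)[OF g(2-4) kx(2,3)])
    ultimately show ?thesis
      using append_tl_assoc[OF chain_not_Nil[OF k(2)]] by simp
  qed
qed

lemma endpoint_delta_act:
  assumes "g \<in> carrier (delta b E)" "c \<in> points (chain_space b E)"
  shows "endpoint (delta_act b E g c) = endpoint c"
proof -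
  obtain gs xs where "g = hclass E gs" "chain E gs" "hd gs = b" "last gs = b"
    "c = hclass E xs" "chain E xs" "hd xs = b"
    using assms by (auto simp: carrier_delta points_chain_space)
  then show ?thesis using delta_act_hclass[of E gs b xs] by (simp add: endpoint_hclass)
qed

text \<open>
  Loops are attached at the start of a chain and steps are added at its end, so the two
  operations commute.
\<close>

lemma star_rel_delta_act:
  assumes E: "E \<in> entourages" "D \<subseteq> E" and g: "g \<in> carrier (delta b E)"
    and cd: "(c, d) \<in> star_rel b E D"
  shows "(delta_act b E g c, delta_act b E g d) \<in> star_rel b E D"
proof -
  obtain gs where gs: "g = hclass E gs" "chain E gs" "hd gs = b" "last gs = b"
    using g by (auto simp: carrier_delta)
  obtain xs z where xs: "c = hclass E xs" "d = hclass E (xs @ [z])" "chain E xs" "hd xs = b"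
    "(last xs, z) \<in> D"
    using star_relE[OF cd E(2)] by blast
  note ne = chain_not_Nil[OF xs(3)] and gx = delta_act_hclass[OF gs(2-4) xs(3,4)]
  have "chain E (xs @ [z])" "hd (xs @ [z]) = b"
    using xs E(2) ne by (auto simp: chain_snoc)
  from delta_act_hclass(1)[OF gs(2-4) this]
  have "delta_act b E g d = hclass E ((gs @ tl xs) @ [z])"
    using ne by (simp add: gs(1) xs(2))
  moreover have "(last (gs @ tl xs), z) \<in> D" using gx(4) xs(5) by simp
  ultimately show ?thesis
    using star_relI[OF E gx(2,3)] gx(1) by (simp add: gs(1) xs(1))
qed

text \<open>
  If \<open>g\<close> followed by \<open>xs\<close> is homotopic to \<open>xs\<close>, then appending the reverse of \<open>xs\<close> to both
  chains shows that \<open>g\<close> is trivial.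
\<close>

lemma delta_act_free:
  assumes E: "E \<in> entourages" and g: "g \<in> carrier (delta b E)"
    and c: "c \<in> points (chain_space b E)" and fix_c: "delta_act b E g c = c"
  shows "g = \<one>\<^bsub>delta b E\<^esub>"
proof -
  obtain gs xs where gs: "g = hclass E gs" "chain E gs" "hd gs = b" "last gs = b"
    and xs: "c = hclass E xs" "chain E xs" "hd xs = b"
    using g c by (auto simp: carrier_delta points_chain_space)
  note gx = delta_act_hclass[OF gs(2-4) xs(2,3)] and ne = chain_not_Nil[OF xs(2)]
  have rev: "chain E (rev xs)" "last xs = hd (rev xs)"
    using chain_rev[OF E xs(2)] ne by (simp_all add: hd_rev)
  have inv: "homotopic E (xs @ tl (rev xs)) [b]"
    using homotopic_inverse[OF E xs(2)] xs(3) by simp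
  have "homotopic E (gs @ tl (xs @ tl (rev xs))) (gs @ tl [b])"
    using inv gs ne xs(3) by (intro homotopic_concat_right) auto
  then have "homotopic E gs ((gs @ tl xs) @ tl (rev xs))"
    unfolding append_tl_assoc[OF ne] by (simp add: homotopic_sym)
  moreover have "homotopic E (gs @ tl xs) xs"
    using fix_c gx(1) by (simp add: gs(1) xs(1) hclass_eq_iff)
  then have "homotopic E ((gs @ tl xs) @ tl (rev xs)) (xs @ tl (rev xs))"
    using gx rev by (intro homotopic_concat_left) auto
  ultimately have "homotopic E gs [b]"
    using inv by (meson homotopic_trans)
  then show ?thesis by (simp add: gs(1) one_delta hclass_eq_iff)
qed

text \<open>
  The translating element is represented by the loop that runs along \<open>ys\<close> and
  back along \<open>xs\<close>.
\<close>

lemma delta_act_transitive: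
  assumes E: "E \<in> entourages" and xs: "chain E xs" "hd xs = b" and ys: "chain E ys" "hd ys = b"
    and last: "last xs = last ys"
  shows "hclass E (ys @ tl (rev xs)) \<in> carrier (delta b E)"
    and "delta_act b E (hclass E (ys @ tl (rev xs))) (hclass E xs) = hclass E ys"
    and "chain E (ys @ tl (rev xs))" "hd (ys @ tl (rev xs)) = b" "last (ys @ tl (rev xs)) = b"
proof -
  have ne: "xs \<noteq> []" using xs(1) by (rule chain_not_Nil)
  have rev: "chain E (rev xs)" "last ys = hd (rev xs)" "last (rev xs) = b"
    using chain_rev[OF E xs(1)] ne last xs(2) by (simp_all add: hd_rev last_rev)
  show loop: "chain E (ys @ tl (rev xs))" "hd (ys @ tl (rev xs)) = b" "last (ys @ tl (rev xs)) = b"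
    using chain_concat[OF ys(1) rev(1,2)] ys(2) rev(3) by auto
  then show "hclass E (ys @ tl (rev xs)) \<in> carrier (delta b E)"
    unfolding carrier_delta by blast
  have "homotopic E (rev xs @ tl xs) [last xs]"
    using homotopic_inverse[OF E rev(1)] ne by (simp add: hd_rev)
  then have "homotopic E (ys @ tl (rev xs @ tl xs)) (ys @ tl [last xs])"
    using ys rev(2) ne by (intro homotopic_concat_right) auto
  moreover have "(ys @ tl (rev xs)) @ tl xs = ys @ tl (rev xs @ tl xs)"
    using ne by simp
  ultimately have "homotopic E ((ys @ tl (rev xs)) @ tl xs) ys"
    by (simp del: append_assoc)
  then show "delta_act b E (hclass E (ys @ tl (rev xs))) (hclass E xs) = hclass E ys"
    using delta_act_hclass(1)[OF loop xs] by (simp add: hclass_eq_iff)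
qed

lemma delta_act_same_endpoint:
  assumes E: "E \<in> entourages" and "c \<in> points (chain_space b E)" "d \<in> points (chain_space b E)"
    and "endpoint c = endpoint d"
  shows "\<exists>g\<in>carrier (delta b E). delta_act b E g c = d"
proof -
  obtain xs ys where "c = hclass E xs" "chain E xs" "hd xs = b" "d = hclass E ys" "chain E ys" "hd ys = b"
    using assms(2,3) by (auto simp: points_chain_space)
  then show ?thesis
    using delta_act_transitive(1,2)[OF E, of xs b ys] assms(4) by (auto simp: endpoint_hclass)
qed

lemma uniform_action_delta:
  assumes E: "E \<in> entourages"
  shows "uniform_action (delta b E) (chain_space b E) (delta_act b E)"
proof (rule uniform_actionI[OF uniform_space_on_chain_space[OF E] group_action_delta[OF E]])
  fix g assume g: "g \<in> carrier (delta b E)"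
  show "ucont (chain_space b E) (chain_space b E) (delta_act b E g)"
    unfolding ucont_iff_eventually eventually_chain_space[OF E]
  proof (intro conjI allI impI)
    show "delta_act b E g \<in> points (chain_space b E) \<rightarrow> points (chain_space b E)"
      using group_action.element_image[OF group_action_delta[OF E] g] by blast
    fix P assume "\<exists>D\<in>entourages. D \<subseteq> E \<and> (\<forall>p\<in>star_rel b E D. P p)"
    then obtain D where "D \<in> entourages" "D \<subseteq> E" "\<And>p. p \<in> star_rel b E D \<Longrightarrow> P p" by blast
    then show "\<exists>D\<in>entourages. D \<subseteq> E \<and>
        (\<forall>p\<in>star_rel b E D. P (delta_act b E g (fst p), delta_act b E g (snd p)))"
      using star_rel_delta_act[OF E _ g, of D] by (intro bexI[of _ D]) auto
  qed
qed

lemma isomorphic_action_delta: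
  assumes E: "E \<in> entourages"
  shows "isomorphic_action (delta b E) (chain_space b E) (delta_act b E)"
  unfolding isomorphic_action_def
proof (intro conjI exI ballI)
  show "uniform_action (delta b E) (chain_space b E) (delta_act b E)"
    by (rule uniform_action_delta[OF E])
  show "uniformity_base (chain_space b E) {star_rel b E D | D. D \<in> entourages \<and> D \<subseteq> E}"
    by (rule uniformity_base_star_rel[OF E])
  fix W g assume "W \<in> {star_rel b E D | D. D \<in> entourages \<and> D \<subseteq> E}" and g: "g \<in> carrier (delta b E)"
  then obtain D where W: "W = star_rel b E D" "D \<subseteq> E" by blast
  show "map_prod (delta_act b E g) (delta_act b E g) ` W = W"
    unfolding W(1)
    by (rule invariantI[OF group_action_delta[OF E] star_rel_subset _ g])
      (rule star_rel_delta_act[OF E W(2)])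
qed

text \<open>
  The action preserves endpoints, and two classes that are related by one step and share
  their endpoint coincide. So the largest basic entourage already witnesses discreteness,
  because the action is free.
\<close>

lemma discrete_action_delta:
  assumes E: "E \<in> entourages"
  shows "discrete_action (delta b E) (chain_space b E) (delta_act b E)"
  unfolding discrete_action_def
proof (intro conjI exI ballI impI)
  show "uniform_action (delta b E) (chain_space b E) (delta_act b E)"
    by (rule uniform_action_delta[OF E])
  show "entourage (chain_space b E) (star_rel b E E)"
    by (rule entourage_star_rel[OF E E]) simp
  fix g assume g: "g \<in> carrier (delta b E)"
    and "\<exists>c\<in>points (chain_space b E). (delta_act b E g c, c) \<in> star_rel b E E"
  then obtain c where c: "c \<in> points (chain_space b E)" "(delta_act b E g c, c) \<in> star_rel b E E"
    by blast
  obtain xs z where xs: "delta_act b E g c = hclass E xs" "c = hclass E (xs @ [z])" "chain E xs"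
    using star_relE[OF c(2) order_refl] by blast
  have "last xs = endpoint (delta_act b E g c)" by (simp only: xs(1) endpoint_hclass)
  also have "\<dots> = endpoint c" by (rule endpoint_delta_act[OF g c(1)])
  also have "\<dots> = z" unfolding xs(2) endpoint_hclass by simp
  finally have "last xs = z" .
  then have "hclass E xs = hclass E (xs @ [z])"
    using homotopic_repeat_last[OF E xs(3)] by (simp add: hclass_eq_iff)
  then have "delta_act b E g c = c"
    unfolding xs(1)[symmetric] xs(2)[symmetric] .
  then show "g = \<one>\<^bsub>delta b E\<^esub>" by (rule delta_act_free[OF E g c(1)])
qed

lemma theta_hclass:
  assumes "F \<subseteq> E" "chain F xs" "hd xs = b" "last xs = b"
  shows "theta b E F (hclass F xs) = hclass E xs"
proof -
  have "hclass F xs \<in> carrier (delta b F)" unfolding carrier_delta using assms by blast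
  then show ?thesis by (simp add: theta_def class_map_hclass[OF assms(1)])
qed

lemma theta_hom:
  assumes "F \<subseteq> E"
  shows "theta b E F \<in> hom (delta b F) (delta b E)"
  unfolding hom_def
proof (intro CollectI conjI ballI funcsetI)
  show "theta b E F x \<in> carrier (delta b E)" if "x \<in> carrier (delta b F)" for x
    using that theta_hclass[OF assms] chain_mono[OF _ assms] unfolding carrier_delta by metis
  fix x y assume "x \<in> carrier (delta b F)" "y \<in> carrier (delta b F)"
  then obtain xs ys where x: "x = hclass F xs" "chain F xs" "hd xs = b" "last xs = b"
    and y: "y = hclass F ys" "chain F ys" "hd ys = b" "last ys = b"
    by (auto simp: carrier_delta)
  have "theta b E F (hclass F (xs @ tl ys)) = hclass E (xs @ tl ys)"
    using chain_concat[of F xs ys] x y by (intro theta_hclass[OF assms]) auto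
  then show "theta b E F (x \<otimes>\<^bsub>delta b F\<^esub> y) = theta b E F x \<otimes>\<^bsub>delta b E\<^esub> theta b E F y"
    using x y chain_mono[OF _ assms]
    by (simp add: mult_delta class_concat_hclass theta_hclass[OF assms])
qed

lemma group_inverse_system_delta:
  assumes "J \<subseteq> entourages" "directed_set J (\<lambda>E F. F \<subseteq> E)"
  shows "group_inverse_system J (\<lambda>E F. F \<subseteq> E) (delta b) (theta b)"
  unfolding group_inverse_system_def
proof (intro conjI ballI impI)
  show "group (delta b E)" if "E \<in> J" for E using that assms(1) group_delta by blast
  show "theta b E F \<in> hom (delta b F) (delta b E)" if "F \<subseteq> E" for E F
    using that by (rule theta_hom)
  show "functorial J (\<lambda>E F. F \<subseteq> E) (\<lambda>E. carrier (delta b E)) (theta b)"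
    unfolding functorial_def
  proof (intro conjI ballI impI)
    show "theta b E E x = x" if "x \<in> carrier (delta b E)" for E x
      using that by (auto simp: carrier_delta theta_hclass)
    fix E F H x assume FE: "F \<subseteq> E" and HF: "H \<subseteq> F" and "x \<in> carrier (delta b H)"
    then obtain xs where "x = hclass H xs" "chain H xs" "hd xs = b" "last xs = b"
      by (auto simp: carrier_delta)
    then show "theta b E F (theta b F H x) = theta b E H x"
      using chain_mono[OF _ HF] FE HF by (simp add: theta_hclass)
  qed
qed (fact assms(2))

lemma class_map_delta_act:
  assumes FE: "F \<subseteq> E" and g: "g \<in> carrier (delta b F)" and c: "c \<in> points (chain_space b F)"
  shows "class_map E F (delta_act b F g c) = delta_act b E (theta b E F g) (class_map E F c)"
proof -
  obtain gs xs where gs: "g = hclass F gs" "chain F gs" "hd gs = b" "last gs = b"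
    and xs: "c = hclass F xs" "chain F xs" "hd xs = b"
    using g c by (auto simp: carrier_delta points_chain_space)
  then show ?thesis
    using chain_mono[OF _ FE] by (simp add: delta_act_hclass theta_hclass[OF FE] class_map_hclass[OF FE])
qed

lemma equivariant_bonds_delta:
  "equivariant_bonds J (\<lambda>E F. F \<subseteq> E) (chain_space b) class_map (delta b) (theta b) (delta_act b)"
  by (simp add: equivariant_bonds_def class_map_delta_act)


section \<open>Covering bases\<close>

lemma system_entourages:
  shows "uspace_inverse_system entourages (\<lambda>E F. F \<subseteq> E) (chain_space b) class_map"
    and "group_inverse_system entourages (\<lambda>E F. F \<subseteq> E) (delta b) (theta b)"
  by (intro uspace_inverse_system_chain_space group_inverse_system_delta order_refl directed_entourages)+

text \<open>
  All coordinates of a point of the limit have the same endpoint, namely its image in \<open>X\<close>.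
\<close>

lemma points_X_tilde:
  assumes "u \<in> points (X_tilde b)"
  shows "E \<in> entourages \<Longrightarrow> u E \<in> points (chain_space b E)"
    and "E \<in> entourages \<Longrightarrow> F \<in> entourages \<Longrightarrow> F \<subseteq> E \<Longrightarrow> class_map E F (u F) = u E"
    and "E \<in> entourages \<Longrightarrow> endpoint (u E) = phi u"
proof -
  show pt: "u E \<in> points (chain_space b E)" if "E \<in> entourages" for E
    using assms that unfolding X_tilde_def points_inverse_limit threads_iff by blast
  show cm: "class_map E F (u F) = u E" if "E \<in> entourages" "F \<in> entourages" "F \<subseteq> E" for E F
    using assms that unfolding X_tilde_def points_inverse_limit threads_iff by blast
  show "endpoint (u E) = phi u" if "E \<in> entourages"
    using endpoint_class_map[OF subset_UNIV pt[OF that]] cm[OF UNIV_entourage that]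
    by (simp add: phi_def)
qed

text \<open>
  The base provided by coverability lies in the covering base, so every entourage contains a
  member of the covering base.
\<close>

lemma coverable_cofinal:
  assumes "coverable b"
  shows "cofinal_in (\<lambda>E F. F \<subseteq> E) entourages (covering_base b)" and "UNIV \<in> covering_base b"
proof -
  obtain B where B: "uniformity_base class_uspace B" "UNIV \<in> B"
    "\<forall>E\<in>B. (\<lambda>u. u E) ` points (X_tilde b) = points (chain_space b E)"
    using assms by (auto simp: coverable_def)
  have BC: "B \<subseteq> covering_base b"
    using B by (auto simp: covering_base_def uniformity_base_def)
  then show "UNIV \<in> covering_base b" using B(2) by blast
  have sub: "covering_base b \<subseteq> entourages" by (auto simp: covering_base_def)
  have cof: "\<exists>F\<in>covering_base b. F \<subseteq> E" if "E \<in> entourages" for E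
    using B(1) BC that unfolding uniformity_base_def by blast
  have "\<exists>H\<in>covering_base b. H \<subseteq> E \<and> H \<subseteq> F" if "E \<in> covering_base b" "F \<in> covering_base b" for E F
    using cof[of "E \<inter> F"] that sub entourage_Int[of class_uspace E F] by blast
  then have "directed_set (covering_base b) (\<lambda>E F. F \<subseteq> E)"
    unfolding directed_set_def using \<open>UNIV \<in> covering_base b\<close> by blast
  then show "cofinal_in (\<lambda>E F. F \<subseteq> E) entourages (covering_base b)"
    unfolding cofinal_in_def using sub cof by blast
qed

text \<open>
  The projection from the limit to the chain space of \<open>E\<close> is onto and factors through
  the chain space of \<open>F\<close>.
\<close>

lemma class_map_surj:
  assumes E: "E \<in> covering_base b" and F: "F \<in> entourages" "F \<subseteq> E"
  shows "class_map E F ` points (chain_space b F) = points (chain_space b E)"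
proof
  show "class_map E F ` points (chain_space b F) \<subseteq> points (chain_space b E)"
    using class_map_point[OF F(2)] by blast
  have Ee: "E \<in> entourages" and im: "(\<lambda>u. u E) ` points (X_tilde b) = points (chain_space b E)"
    using E by (auto simp: covering_base_def)
  show "points (chain_space b E) \<subseteq> class_map E F ` points (chain_space b F)"
    unfolding im[symmetric]
  proof (rule image_subsetI)
    fix u assume u: "u \<in> points (X_tilde b)"
    show "u E \<in> class_map E F ` points (chain_space b F)"
      using points_X_tilde(2)[OF u Ee F, symmetric] points_X_tilde(1)[OF u F(1)] by (rule image_eqI)
  qed
qed

text \<open>
  A surjective bonding map lifts one-step extensions: lift the class of \<open>xs\<close> to an \<open>F\<close>-chain
  \<open>ys\<close>, which has the same endpoint, and append the same point to it.
\<close>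

lemma unif_chain_space_image:
  assumes E: "E \<in> entourages" and F: "F \<in> entourages" "F \<subseteq> E"
    and surj: "class_map E F ` points (chain_space b F) = points (chain_space b E)"
  shows "unif (chain_space b E) =
     filtermap (\<lambda>(c, d). (class_map E F c, class_map E F d)) (unif (chain_space b F))"
proof (rule antisym)
  show "filtermap (\<lambda>(c, d). (class_map E F c, class_map E F d)) (unif (chain_space b F))
      \<le> unif (chain_space b E)"
    using ucont_class_map[OF E F] by (simp add: ucont_def filterlim_def)
  show "unif (chain_space b E) \<le>
      filtermap (\<lambda>(c, d). (class_map E F c, class_map E F d)) (unif (chain_space b F))"
  proof (rule filter_leI)
    fix P assume "eventually P (filtermap (\<lambda>(c, d). (class_map E F c, class_map E F d)) (unif (chain_space b F)))"
    then obtain D where D: "D \<in> entourages" "D \<subseteq> F"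
      and P_image: "\<forall>p\<in>star_rel b F D. P (case p of (c, d) \<Rightarrow> (class_map E F c, class_map E F d))"
      unfolding eventually_filtermap eventually_chain_space[OF F(1)] by blast
    have P: "P (class_map E F c, class_map E F d)" if "(c, d) \<in> star_rel b F D" for c d
      using bspec[OF P_image that] by simp
    have DE: "D \<subseteq> E" using D(2) F(2) by blast
    have "P p" if p: "p \<in> star_rel b E D" for p
    proof -
      obtain c d where cd: "p = (c, d)" by (cases p)
      obtain xs z where "c = hclass E xs" "d = hclass E (xs @ [z])" and xs: "chain E xs" "hd xs = b"
        "(last xs, z) \<in> D"
        using star_relE[OF p[unfolded cd] DE] by blast
      with cd have pz: "p = (hclass E xs, hclass E (xs @ [z]))" by simp
      have "hclass E xs \<in> class_map E F ` points (chain_space b F)"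
        unfolding surj points_chain_space using xs by blast
      then obtain ys where ys: "hclass E xs = hclass E ys" "chain F ys" "hd ys = b"
        by (auto simp: points_chain_space class_map_hclass[OF F(2)])
      have "last ys = last xs" using hclass_endpoints[OF ys(1)] by simp
      then have "P (hclass E ys, hclass E (ys @ [z]))"
        using P[OF star_relI[OF F(1) D(2) ys(2,3)]] xs(3) by (simp add: class_map_hclass[OF F(2)])
      then show ?thesis
        using hclass_snoc_cong[OF ys(1) xs(1)] xs(3) DE ys(1) by (auto simp: pz)
    qed
    then show "eventually P (unif (chain_space b E))"
      unfolding eventually_chain_space[OF E] using D(1) DE by blast
  qed
qed

lemma discrete_cover_class_map:
  assumes E: "E \<in> covering_base b" and F: "F \<in> entourages" "F \<subseteq> E"
  shows "discrete_cover (chain_space b F) (chain_space b E) (class_map E F)"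
proof -
  have Ee: "E \<in> entourages" using E by (simp add: covering_base_def)
  note surj = class_map_surj[OF E F]
  show ?thesis
  proof (rule discrete_cover_of_equivariant[OF discrete_action_delta[OF F(1)]
        isomorphic_action_delta[OF F(1)] group_delta[OF Ee] theta_hom[OF F(2)]])
    show "class_map E F (delta_act b F g c) = delta_act b E (theta b E F g) (class_map E F c)"
      if "g \<in> carrier (delta b F)" "c \<in> points (chain_space b F)" for g c
      using that by (rule class_map_delta_act[OF F(2)])
    show "delta_act b E \<one>\<^bsub>delta b E\<^esub> c = c" if "c \<in> points (chain_space b E)" for c
      using group_action.id_eq_one[OF group_action_delta[OF Ee], of b] that by (metis restrict_apply')
    show "g = \<one>\<^bsub>delta b E\<^esub>"
      if "g \<in> carrier (delta b E)" "c \<in> points (chain_space b E)" "delta_act b E g c = c" for g c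
      using that by (rule delta_act_free[OF Ee])
    show "unif (chain_space b E) =
        filtermap (\<lambda>(c, d). (class_map E F c, class_map E F d)) (unif (chain_space b F))"
      by (rule unif_chain_space_image[OF Ee F surj])
    show "\<exists>g\<in>carrier (delta b F). delta_act b F g c = d"
      if "c \<in> points (chain_space b F)" "d \<in> points (chain_space b F)" "class_map E F c = class_map E F d" for c d
      using that endpoint_class_map[OF F(2)] by (intro delta_act_same_endpoint[OF F(1)]) metis+
  qed (rule surj)
qed

lemma phi_surj:
  assumes "coverable b" shows "phi ` points (X_tilde b) = UNIV"
proof -
  have "endpoint ` (\<lambda>u. u UNIV) ` points (X_tilde b) = UNIV"
    using coverable_cofinal(2)[OF assms] bij_betw_endpoint_UNIV[of b]
    by (simp add: covering_base_def bij_betw_def)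
  then show ?thesis by (simp add: image_image phi_def)
qed

text \<open>
  For the harder inclusion a member \<open>H\<close> of the covering base is used twice. A pair \<open>(y, z)\<close> in \<open>H\<close>
  is lifted by choosing a point of the limit over \<open>y\<close>, extending its \<open>H\<close>-coordinate by
  the step to \<open>z\<close>, and lifting the extended class back to the limit, which is possible
  because the projection to the chain space of \<open>H\<close> is onto. The two lifts are close at
  \<open>H\<close>, hence at every larger entourage.
\<close>

lemma unif_class_uspace_phi:
  fixes b :: "'a::uniform_space"
  assumes "coverable b"
  shows "unif class_uspace = filtermap (\<lambda>(u, v). (phi u, phi v)) (unif (X_tilde b))"
proof (rule antisym)
  have ev: "eventually P (unif (X_tilde b)) \<longleftrightarrow>
     (\<exists>E\<in>entourages. \<exists>Q. eventually Q (unif (chain_space b E)) \<and>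
        (\<forall>u\<in>points (X_tilde b). \<forall>v\<in>points (X_tilde b). Q (u E, v E) \<longrightarrow> P (u, v)))" for P
    unfolding X_tilde_def by (rule eventually_inverse_limit[OF system_entourages(1)])
  show "filtermap (\<lambda>(u, v). (phi u, phi v)) (unif (X_tilde b)) \<le> unif class_uspace"
  proof (rule filter_leI)
    fix P :: "'a \<times> 'a \<Rightarrow> bool" assume "eventually P (unif class_uspace)"
    then obtain D where D: "D \<in> entourages" and P: "\<And>p. p \<in> D \<Longrightarrow> P p"
      using entourage_within[OF uniform_space_on_class_uspace] by blast
    have "eventually (\<lambda>p. p \<in> star_rel b D D) (unif (chain_space b D))"
      using entourage_star_rel[OF D D order_refl] by (simp add: entourage_def)
    moreover have "P (phi u, phi v)" if u: "u \<in> points (X_tilde b)" and v: "v \<in> points (X_tilde b)"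
      and uv: "(u D, v D) \<in> star_rel b D D" for u v
    proof -
      obtain xs z where xs: "u D = hclass D xs" "v D = hclass D (xs @ [z])" "(last xs, z) \<in> D"
        using star_relE[OF uv order_refl] by blast
      have "phi u = last xs" "phi v = z"
        using points_X_tilde(3)[OF u D] points_X_tilde(3)[OF v D] xs by (simp_all add: endpoint_hclass)
      then show ?thesis using P xs(3) by simp
    qed
    ultimately show "eventually P (filtermap (\<lambda>(u, v). (phi u, phi v)) (unif (X_tilde b)))"
      unfolding eventually_filtermap ev using D
      by (intro bexI[of _ D] exI[of _ "\<lambda>p. p \<in> star_rel b D D"]) auto
  qed
  show "unif class_uspace \<le> filtermap (\<lambda>(u, v). (phi u, phi v)) (unif (X_tilde b))"
  proof (rule filter_leI)
    fix P assume "eventually P (filtermap (\<lambda>(u, v). (phi u, phi v)) (unif (X_tilde b)))"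
    then obtain E Q where E: "E \<in> entourages" and Q: "eventually Q (unif (chain_space b E))"
      and P: "\<And>u v. u \<in> points (X_tilde b) \<Longrightarrow> v \<in> points (X_tilde b) \<Longrightarrow> Q (u E, v E) \<Longrightarrow> P (phi u, phi v)"
      unfolding eventually_filtermap ev by auto
    obtain D where D: "D \<in> entourages" "D \<subseteq> E" "\<And>p. p \<in> star_rel b E D \<Longrightarrow> Q p"
      using Q unfolding eventually_chain_space[OF E] by blast
    obtain H where HC: "H \<in> covering_base b" and HD: "H \<subseteq> D"
      using coverable_cofinal(1)[OF assms] D(1) unfolding cofinal_in_def by blast
    have H: "H \<in> entourages" and im: "(\<lambda>u. u H) ` points (X_tilde b) = points (chain_space b H)"
      using HC by (auto simp: covering_base_def)
    have HE: "H \<subseteq> E" using HD D(2) by blast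
    have "P p" if "p \<in> H" for p
    proof -
      obtain y z where p: "p = (y, z)" by (cases p)
      have "y \<in> phi ` points (X_tilde b)" by (simp add: phi_surj[OF assms])
      then obtain u where u: "u \<in> points (X_tilde b)" "phi u = y" by blast
      obtain xs where xs: "u H = hclass H xs" "chain H xs" "hd xs = b"
        using points_X_tilde(1)[OF u(1) H] by (auto simp: points_chain_space)
      have last: "last xs = y" using points_X_tilde(3)[OF u(1) H] u(2) xs(1) by (simp add: endpoint_hclass)
      then have yz: "(last xs, z) \<in> H" using that p by simp
      have "hclass H (xs @ [z]) \<in> points (chain_space b H)"
        unfolding points_chain_space using xs(2,3) yz chain_not_Nil[OF xs(2)]
        by (intro exI[of _ "xs @ [z]"]) (simp add: chain_snoc)
      then obtain v where v: "v \<in> points (X_tilde b)" "v H = hclass H (xs @ [z])"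
        unfolding im[symmetric] by auto
      have "phi v = z" using points_X_tilde(3)[OF v(1) H] v(2) by (simp add: endpoint_hclass)
      have "(u H, v H) \<in> star_rel b H H"
        unfolding xs(1) v(2) by (rule star_relI[OF H order_refl xs(2,3) yz])
      from star_rel_class_map[OF HE this] have "(u E, v E) \<in> star_rel b E H"
        by (simp add: points_X_tilde(2)[OF u(1) E H HE] points_X_tilde(2)[OF v(1) E H HE])
      then have "Q (u E, v E)" using D(3) star_rel_mono[OF HD] by blast
      then show ?thesis using P u v \<open>phi v = z\<close> p by auto
    qed
    moreover have "eventually (\<lambda>p. p \<in> H) (unif class_uspace)"
      using H by (simp add: entourage_def)
    ultimately show "eventually P (unif class_uspace)"
      by (auto elim: eventually_mono)
  qed
qed

lemma delta_1_act_limit_act: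
  "delta_1_act b = limit_act entourages (\<lambda>E F. F \<subseteq> E) (chain_space b) class_map (delta_act b)"
  by (simp add: fun_eq_iff delta_1_act_def limit_act_def X_tilde_def)

text \<open>
  Two points of the limit over the same point of \<open>X\<close> have equal endpoints in every coordinate, so
  each coordinate can be translated by a loop class; freeness assembles the loop classes
  into an element of the limit group.
\<close>

lemma phi_eq_iff_orbit:
  assumes u: "u \<in> points (X_tilde b)" and v: "v \<in> points (X_tilde b)"
  shows "phi u = phi v \<longleftrightarrow> v \<in> orbit (delta_1 b) (delta_1_act b) u"
proof
  assume eq: "phi u = phi v"
  have "\<exists>g\<in>carrier (delta_1 b). delta_1_act b g u = v"
    unfolding delta_1_def delta_1_act_limit_act
  proof (rule same_orbit_limit[OF system_entourages equivariant_bonds_delta])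
    show "uniform_action (delta b E) (chain_space b E) (delta_act b E)" if "E \<in> entourages" for E
      using that by (rule uniform_action_delta)
    show "g = \<one>\<^bsub>delta b E\<^esub>" if "E \<in> entourages" "g \<in> carrier (delta b E)"
      "c \<in> points (chain_space b E)" "delta_act b E g c = c" for E g c
      using that by (rule delta_act_free)
    show "\<exists>g\<in>carrier (delta b E). delta_act b E g (u E) = v E" if "E \<in> entourages" for E
      using points_X_tilde[OF u] points_X_tilde[OF v] that eq
      by (intro delta_act_same_endpoint) auto
  qed (use u v in \<open>simp_all add: X_tilde_def\<close>)
  then show "v \<in> orbit (delta_1 b) (delta_1_act b) u" by (auto simp: orbit_def)
next
  assume "v \<in> orbit (delta_1 b) (delta_1_act b) u"
  then obtain g where g: "g \<in> carrier (delta_1 b)" "v = delta_1_act b g u"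
    by (auto simp: orbit_def)
  have "g UNIV \<in> carrier (delta b UNIV)"
    using g(1) UNIV_entourage unfolding delta_1_def carrier_inverse_limit threads_iff by blast
  then have "endpoint (delta_act b UNIV (g UNIV) (u UNIV)) = endpoint (u UNIV)"
    by (rule endpoint_delta_act[OF _ points_X_tilde(1)[OF u UNIV_entourage]])
  moreover have "v UNIV = delta_act b UNIV (g UNIV) (u UNIV)"
    by (simp add: g(2) delta_1_act_def u UNIV_entourage del: mem_Collect_eq)
  ultimately show "phi u = phi v" by (simp add: phi_def)
qed

theorem theorem43:
  fixes b :: "'a::uniform_space"
  assumes "coverable b"
  shows "inverse_system_of_discrete_covers (covering_base b) (\<lambda>E F. F \<subseteq> E)
           (chain_space b) class_map (delta b) (theta b) (delta_act b) \<and>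
         cover_with_group TYPE('a rel) TYPE('a list set) TYPE('a list set)
           (delta_1 b) (delta_1_act b) (X_tilde b) class_uspace phi"
proof
  have sub: "covering_base b \<subseteq> entourages" and dir: "directed_set (covering_base b) (\<lambda>E F. F \<subseteq> E)"
    using coverable_cofinal(1)[OF assms] by (simp_all add: cofinal_in_def)
  show "inverse_system_of_discrete_covers (covering_base b) (\<lambda>E F. F \<subseteq> E)
           (chain_space b) class_map (delta b) (theta b) (delta_act b)"
    unfolding inverse_system_of_discrete_covers_def
  proof (intro conjI ballI impI)
    show "uspace_inverse_system (covering_base b) (\<lambda>E F. F \<subseteq> E) (chain_space b) class_map"
      by (rule uspace_inverse_system_chain_space[OF sub dir])
    show "group_inverse_system (covering_base b) (\<lambda>E F. F \<subseteq> E) (delta b) (theta b)"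
      by (rule group_inverse_system_delta[OF sub dir])
    show "discrete_action (delta b E) (chain_space b E) (delta_act b E)" if "E \<in> covering_base b" for E
      using that sub discrete_action_delta by blast
    show "isomorphic_action (delta b E) (chain_space b E) (delta_act b E)" if "E \<in> covering_base b" for E
      using that sub isomorphic_action_delta by blast
    show "discrete_cover (chain_space b F) (chain_space b E) (class_map E F)"
      if "E \<in> covering_base b" "F \<in> covering_base b" "F \<subseteq> E" for E F
      using that sub discrete_cover_class_map by blast
  qed (rule equivariant_bonds_delta)
  have limits: "X_tilde b = inverse_limit_uspace entourages (\<lambda>E F. F \<subseteq> E) (chain_space b) class_map"
    "delta_1 b = inverse_limit_group entourages (\<lambda>E F. F \<subseteq> E) (delta b) (theta b)"
    by (simp_all add: X_tilde_def delta_1_def)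
  have "prodiscrete_action TYPE('a rel) TYPE('a list set) TYPE('a list set)
      (delta_1 b) (X_tilde b) (delta_1_act b)"
    unfolding limits delta_1_act_limit_act
  proof (rule prodiscrete_action_limit[OF system_entourages equivariant_bonds_delta _ coverable_cofinal(1)[OF assms]])
    show "discrete_action (delta b E) (chain_space b E) (delta_act b E)" if "E \<in> entourages" for E
      using that by (rule discrete_action_delta)
    show "(\<lambda>u. u E) ` points (inverse_limit_uspace entourages (\<lambda>E F. F \<subseteq> E) (chain_space b) class_map) =
        points (chain_space b E)" if "E \<in> covering_base b" for E
      using that by (simp add: covering_base_def X_tilde_def)
  qed
  moreover have iso: "isomorphic_action (delta_1 b) (X_tilde b) (delta_1_act b)"
    unfolding limits delta_1_act_limit_act
    by (rule isomorphic_action_limit[OF system_entourages equivariant_bonds_delta])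
      (simp_all add: uniform_action_delta isomorphic_action_delta)
  moreover have "quotient_map_upto_uhomeo (delta_1 b) (delta_1_act b) (X_tilde b) class_uspace phi"
  proof (rule quotient_map_upto_uhomeoI)
    show "uniform_space_on (X_tilde b)" "group_action (delta_1 b) (points (X_tilde b)) (delta_1_act b)"
      using iso by (simp_all add: isomorphic_action_def uniform_action_def)
    show "phi ` points (X_tilde b) = points class_uspace"
      using phi_surj[OF assms] by (simp add: class_uspace_def)
    show "unif class_uspace = filtermap (\<lambda>(u, v). (phi u, phi v)) (unif (X_tilde b))"
      by (rule unif_class_uspace_phi[OF assms])
  qed (rule phi_eq_iff_orbit)
  ultimately show "cover_with_group TYPE('a rel) TYPE('a list set) TYPE('a list set)
      (delta_1 b) (delta_1_act b) (X_tilde b) class_uspace phi"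
    by (simp add: cover_with_group_def)
qed

end
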